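(* Let $n\ge 2$, $\rho\in(0,1/2]$, $1\le m\le n-1$ and $s\in(0,1]$. Then $$\mathcal{E}_{m,1}\le 3en\,(1/\rho)^{\lfloor n/2\rfloor}\qquad\text{and}\qquad \mathcal{E}_{m,s}\le (c/s)^m(1/\rho)^{n-1},$$ where $c=Cmn$ for an absolute constant $C>0$.
   Context: Fix $n\ge 2$ and a weight threshold $\rho\in(0,1/2]$. An averaging system consists of: - a sequence $(G_t)_{t\ge0}$ of undirected graphs on the vertex set $[n]$, each containing a self-loop at every vertex; - $n\times n$ row-stochastic matrices $P_t$ such that $(P_t)_{ij}>0$ if and only if $\{i,j\}$ is an edge of $G_t$ (so the diagonal is positive), and every nonzero entry of $P_t$ is at least $\rho$. Given $x(0)\in\mathbb{R}^n$, set $x(t+1)=P_tx(t)$ for $t\ge 0$. At time $t$, every edge $\{i,j\}$ of $G_t$ with $i\ne j$ is embedded as the closed interval with endpoints $x_i(t)$ and $x_j(t)$. The union of these intervals is a disjoint union of closed intervals, called blocks, with lengths $l_1(t),\dots,l_{k_t}(t)$. For $s\in(0,1]$ put $E_{s,t}=\sum_{i=1}^{k_t}l_i(t)^s$ and define the $s$-energy as $E_s=\sum_{t\ge0}E_{s,t}$. Let $\mathcal{E}_{m,s}$ denote the supremum of $E_s$ over all averaging systems (with the given $n$ and $\rho$) in which every $G_t$ has at most $m$ connected components, and over all initial positions $x(0)\in[0,1]^n$. *)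

theory Defs
  imports "HOL-Analysis.Analysis"
begin

text \<open>Vertices are 0..<n. A system is given by the matrices P t (entries P t i j for i,j < n);
  the graph G_t is determined by the positivity pattern of P t.\<close>

definition avg_system :: "nat \<Rightarrow> real \<Rightarrow> (nat \<Rightarrow> nat \<Rightarrow> nat \<Rightarrow> real) \<Rightarrow> bool" where
  "avg_system n \<rho> P \<longleftrightarrow>
     (\<forall>t. \<forall>i<n. \<forall>j<n. 0 \<le> P t i j \<and> (0 < P t i j \<longleftrightarrow> 0 < P t j i)
                       \<and> (0 < P t i j \<longrightarrow> \<rho> \<le> P t i j)) \<and>
     (\<forall>t. \<forall>i<n. 0 < P t i i \<and> (\<Sum>j<n. P t i j) = 1)"

definition graph_edges :: "nat \<Rightarrow> (nat \<Rightarrow> nat \<Rightarrow> nat \<Rightarrow> real) \<Rightarrow> nat \<Rightarrow> (nat \<times> nat) set" where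
  "graph_edges n P t = {(i, j). i < n \<and> j < n \<and> 0 < P t i j}"

definition num_components :: "nat \<Rightarrow> (nat \<Rightarrow> nat \<Rightarrow> nat \<Rightarrow> real) \<Rightarrow> nat \<Rightarrow> nat" where
  "num_components n P t = card ({0..<n} // ((graph_edges n P t)\<^sup>*))"

fun traj :: "nat \<Rightarrow> (nat \<Rightarrow> nat \<Rightarrow> nat \<Rightarrow> real) \<Rightarrow> (nat \<Rightarrow> real) \<Rightarrow> nat \<Rightarrow> nat \<Rightarrow> real" where
  "traj n P x0 0 = x0"
| "traj n P x0 (Suc t) = (\<lambda>i. \<Sum>j<n. P t i j * traj n P x0 t j)"

text \<open>Union of the embedded edge intervals at time t.\<close>
definition edge_union :: "nat \<Rightarrow> (nat \<Rightarrow> nat \<Rightarrow> nat \<Rightarrow> real) \<Rightarrow> (nat \<Rightarrow> real) \<Rightarrow> nat \<Rightarrow> real set" where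
  "edge_union n P x0 t =
     (\<Union>(i, j) \<in> {(i, j). i < n \<and> j < n \<and> i \<noteq> j \<and> 0 < P t i j}.
        {min (traj n P x0 t i) (traj n P x0 t j) .. max (traj n P x0 t i) (traj n P x0 t j)})"

text \<open>E_{s,t}: sum of s-th powers of the lengths of the blocks (connected components of the union).\<close>
definition energy_t :: "nat \<Rightarrow> (nat \<Rightarrow> nat \<Rightarrow> nat \<Rightarrow> real) \<Rightarrow> (nat \<Rightarrow> real) \<Rightarrow> real \<Rightarrow> nat \<Rightarrow> real" where
  "energy_t n P x0 s t = (\<Sum>c\<in>components (edge_union n P x0 t). (Sup c - Inf c) powr s)"

definition energy :: "nat \<Rightarrow> (nat \<Rightarrow> nat \<Rightarrow> nat \<Rightarrow> real) \<Rightarrow> (nat \<Rightarrow> real) \<Rightarrow> real \<Rightarrow> ennreal" where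
  "energy n P x0 s = (\<Sum>t. ennreal (energy_t n P x0 s t))"

text \<open>\<E>_{m,s}: supremum over systems with at most m components at every time and x(0) in [0,1]^n.\<close>
definition max_energy :: "nat \<Rightarrow> real \<Rightarrow> nat \<Rightarrow> real \<Rightarrow> ennreal" where
  "max_energy n \<rho> m s =
     (SUP (P, x0) \<in> {(P, x0). avg_system n \<rho> P \<and> (\<forall>t. num_components n P t \<le> m)
                        \<and> (\<forall>i<n. x0 i \<in> {0..1})}. energy n P x0 s)"

end

theory Submission
  imports Defs
begin

text \<open>Sort the agents at every time. If the gap \<open>p\<close> lies inside a block, then averaging pulls the agents
  on its two sides towards each other by a \<open>\<rho>\<close>-fraction. Hence a linear functional of the sorted
  positions whose weights decrease like \<open>\<rho> ^ j\<close> from both ends towards the middle, the spread \<open>V\<close>, never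
  increases, and it drops by at least \<open>\<rho> ^ k / n\<close> times the length of each covered gap, where \<open>k\<close> is the
  rank of the gap counted from the nearer end, so \<open>k \<le> n / 2\<close>. Summing the drops bounds the 1-energy.

  For the \<open>s\<close>-energy one inducts on the number \<open>m\<close> of blocks. Let \<open>D\<close> be the diameter. If all gaps are
  shorter than \<open>D / (2 m)\<close>, then half of the diameter is covered and \<open>V\<close> drops at once. Otherwise fix a gap of
  length at least \<open>D / (2 m)\<close>, with rank \<open>k\<close>. Until it is covered, the two sides are independent systems with
  at most \<open>m - 1\<close> blocks each and at most \<open>n - k\<close> agents, which by induction costs energy of order
  \<open>\<rho> ^ -(n - k - 1) * D ^ s\<close>; when it is covered, \<open>V\<close> drops by \<open>\<rho> ^ k * D / (2 m n)\<close>. Since \<open>V \<le> D\<close>, a multiple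
  of \<open>V ^ s\<close> of order \<open>\<rho> ^ -(n - 1) * m * n / s\<close> pays for this.\<close>

section \<open>Concavity of powers\<close>

text \<open>Weighted AM-GM, divided by \<open>v powr (1 - s)\<close>, is the tangent bound for the
  concave power.\<close>

lemma powr_le_tangent:
  fixes s v w :: real
  assumes "0 < s" "s \<le> 1" "0 < v" "0 \<le> w"
  shows "w powr s \<le> v powr s - s * (v - w) * v powr (s - 1)"
proof (cases "w = 0")
  case True
  have "v * v powr (s - 1) = v powr s"
    using assms by (simp add: powr_diff)
  moreover have "s * v powr s \<le> v powr s"
    using assms by (intro mult_left_le_one_le) auto
  ultimately show ?thesis
    using True assms by (simp add: mult.assoc)
next
  case False
  have "w powr s * v powr (1 - s) \<le> s * w + (1 - s) * v"
    using assms False by (intro Youngs_inequality_0) auto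
  then have "w powr s * v powr (1 - s) * v powr (s - 1) \<le> (s * w + (1 - s) * v) * v powr (s - 1)"
    by (intro mult_right_mono) auto
  moreover have "v powr (1 - s) * v powr (s - 1) = 1" "v * v powr (s - 1) = v powr s"
    using assms by (simp_all add: powr_diff)
  ultimately show ?thesis
    by (simp add: algebra_simps)
qed

text \<open>Turns a linear drop of the potential into a drop of its power: as
  \<open>v \<le> d\<close> and \<open>s \<le> 1\<close>, the slope of the power at \<open>v\<close>
  is at least its slope at \<open>d\<close>.\<close>

lemma powr_drop:
  fixes s v w d \<eta> :: real
  assumes "0 < s" "s \<le> 1" "0 < \<eta>" "0 < d" "0 \<le> w" "w \<le> v - \<eta> * d" "v \<le> d"
  shows "w powr s + s * \<eta> * d powr s \<le> v powr s"
proof -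
  have "0 < \<eta> * d" using assms by simp
  then have v: "0 < v" "w \<le> v" using assms by linarith+
  have "\<eta> * d powr s = \<eta> * d * d powr (s - 1)"
    using assms by (simp add: powr_diff)
  also have "\<dots> \<le> (v - w) * v powr (s - 1)"
    using assms v by (intro mult_mono powr_mono2') auto
  finally have "s * \<eta> * d powr s \<le> s * (v - w) * v powr (s - 1)"
    using assms(1) by (simp add: mult.assoc)
  then show ?thesis
    using powr_le_tangent[OF assms(1,2) v(1) assms(5)] by linarith
qed

text \<open>Since \<open>s - 1 \<le> 0\<close>, replacing the factor
  \<open>(x + y) powr (s - 1)\<close> by the same power of a single nonzero summand can only
  increase it.\<close>

lemma powr_add_le:
  fixes x y s :: real
  assumes "0 < s" "s \<le> 1" "0 \<le> x" "0 \<le> y"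
  shows "(x + y) powr s \<le> x powr s + y powr s"
proof (cases "x + y = 0")
  case True
  then show ?thesis using assms by simp
next
  case False
  then have p: "0 < x + y" using assms by linarith
  have frac: "z * (x + y) powr (s - 1) \<le> z powr s" if "0 \<le> z" "z \<le> x + y" for z
  proof (cases "z = 0")
    case False
    then have "z * (x + y) powr (s - 1) \<le> z * z powr (s - 1)"
      using that assms by (intro mult_left_mono powr_mono2') auto
    then show ?thesis
      using False that by (simp add: powr_diff)
  qed simp
  have "(x + y) powr s = (x + y) * (x + y) powr (s - 1)"
    using p by (simp add: powr_diff)
  then show ?thesis
    using frac[of x] frac[of y] assms by (simp add: algebra_simps)
qed

lemma powr_sum_le:
  fixes f :: "'a \<Rightarrow> real"
  assumes "0 < s" "s \<le> 1" "\<And>i. i \<in> I \<Longrightarrow> 0 \<le> f i"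
  shows "(\<Sum>i\<in>I. f i) powr s \<le> (\<Sum>i\<in>I. f i powr s)"
  using assms(3)
proof (induction I rule: infinite_finite_induct)
  case (insert i I)
  have "(f i + sum f I) powr s \<le> f i powr s + sum f I powr s"
    using insert.prems assms(1,2) by (intro powr_add_le sum_nonneg) auto
  then show ?case using insert by fastforce
qed auto

section \<open>The spread functional\<close>

text \<open>The factor \<open>1 - j/h\<close> makes \<open>\<rho> * weight j - weight (Suc j)\<close> positive and of order
  \<open>\<rho> ^ Suc j / h\<close> without losing an exponential factor over the \<open>h\<close> levels.\<close>

definition weight :: "real \<Rightarrow> nat \<Rightarrow> nat \<Rightarrow> real" where
  "weight \<rho> h j = \<rho> ^ j * (1 - real j / real h)"

lemma weight_ends: "weight \<rho> h 0 = 1" "0 < h \<Longrightarrow> weight \<rho> h h = 0"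
  by (simp_all add: weight_def)

lemma weight_decay:
  assumes "0 < h"
  shows "\<rho> * weight \<rho> h j - weight \<rho> h (Suc j) = \<rho> ^ Suc j / real h"
  using assms by (simp add: weight_def field_simps)

lemma weight_Suc_le:
  assumes "0 \<le> \<rho>" "\<rho> \<le> 1" "j < h"
  shows "weight \<rho> h (Suc j) \<le> weight \<rho> h j"
  unfolding weight_def using assms
  by (intro mult_mono power_decreasing) (auto simp: field_simps)

text \<open>Summation by parts: the coefficient of \<open>f j\<close> collects its own gain and,
  telescoped, the losses it causes at all later levels.\<close>

lemma sum_weight_parts:
  fixes S f :: "nat \<Rightarrow> real"
  shows "(\<Sum>j<h. (S j - S (Suc j)) * (\<rho> * f j - (1 - \<rho>) * (\<Sum>l<j. f l)))
       = (\<Sum>j<h. (\<rho> * S j - S (Suc j)) * f j) + (1 - \<rho>) * S h * (\<Sum>l<h. f l)"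
  by (induction h) (auto simp: algebra_simps)

text \<open>Meant for \<open>f j\<close> the crossed gap at rank \<open>j\<close> from one end and
  \<open>\<delta> j\<close> the inward motion of the agent there. Crossed gaps nearer the end may
  push that agent outward; the weights decay fast enough to absorb this.\<close>

lemma weighted_gain:
  fixes f \<delta> :: "nat \<Rightarrow> real"
  assumes \<rho>: "0 \<le> \<rho>" "\<rho> \<le> 1" and h: "0 < h"
    and \<delta>: "\<And>j. j < h \<Longrightarrow> \<rho> * f j - (1 - \<rho>) * (\<Sum>l<j. f l) \<le> \<delta> j"
  shows "(\<Sum>j<h. \<rho> ^ Suc j / real h * f j)
         \<le> (\<Sum>j<h. (weight \<rho> h j - weight \<rho> h (Suc j)) * \<delta> j)"
proof -
  have "(\<Sum>j<h. \<rho> ^ Suc j / real h * f j)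
      = (\<Sum>j<h. (\<rho> * weight \<rho> h j - weight \<rho> h (Suc j)) * f j)"
    using weight_decay[OF h] by simp
  also have "\<dots> = (\<Sum>j<h. (weight \<rho> h j - weight \<rho> h (Suc j)) * (\<rho> * f j - (1 - \<rho>) * (\<Sum>l<j. f l)))"
    using weight_ends(2)[OF h] by (simp add: sum_weight_parts)
  also have "\<dots> \<le> (\<Sum>j<h. (weight \<rho> h j - weight \<rho> h (Suc j)) * \<delta> j)"
    using \<delta> weight_Suc_le[OF \<rho>] by (intro sum_mono mult_left_mono) auto
  finally show ?thesis .
qed

definition gap :: "(nat \<Rightarrow> real) \<Rightarrow> nat \<Rightarrow> real" where
  "gap x p = x (Suc p) - x p"

text \<open>Rank \<open>u\<close> is the lowest of its block. The form with \<open>Suc p = u\<close>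
  makes the condition vacuous at rank 0.\<close>

definition left_closed :: "nat set \<Rightarrow> nat \<Rightarrow> bool" where
  "left_closed C u \<longleftrightarrow> (\<forall>p. Suc p = u \<longrightarrow> p \<notin> C)"

text \<open>Here \<open>x\<close> and \<open>y\<close> are the sorted positions before and after a step, and \<open>C\<close> is the set of
  those \<open>p\<close> for which the gap between \<open>p\<close> and \<open>Suc p\<close> is covered by an edge, so that the blocks are
  the maximal runs of \<open>C\<close>.\<close>

definition contraction_step ::
  "nat \<Rightarrow> real \<Rightarrow> nat set \<Rightarrow> (nat \<Rightarrow> real) \<Rightarrow> (nat \<Rightarrow> real) \<Rightarrow> bool" where
  "contraction_step n \<rho> C x y \<longleftrightarrow>
     (\<forall>i j. i \<le> j \<longrightarrow> j < n \<longrightarrow> x i \<le> x j) \<and>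
     (\<forall>p\<in>C. Suc p < n) \<and>
     (\<forall>u i. u \<le> i \<longrightarrow> i < n \<longrightarrow> left_closed C u \<longrightarrow>
        x u + \<rho> * (x (if i \<in> C then Suc i else i) - x u) \<le> y i) \<and>
     (\<forall>i v. i \<le> v \<longrightarrow> v < n \<longrightarrow> v \<notin> C \<longrightarrow>
        y i \<le> x v - \<rho> * (x v - x (if left_closed C i then i else i - 1)))"

definition crossed_gap :: "nat set \<Rightarrow> (nat \<Rightarrow> real) \<Rightarrow> nat \<Rightarrow> real" where
  "crossed_gap C x p = (if p \<in> C then gap x p else 0)"

text \<open>The functional after summation by parts: for \<open>a < e\<close> and
  \<open>\<rho>\<close> between 0 and 1 it is a convex combination of the widths of the nested
  intervals from \<open>a + j\<close> to \<open>e - j\<close>, which yields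
  \<open>spread_nonneg\<close> and \<open>spread_le\<close>.\<close>

definition spread :: "real \<Rightarrow> nat \<Rightarrow> nat \<Rightarrow> (nat \<Rightarrow> real) \<Rightarrow> real" where
  "spread \<rho> a e x = (let h = (e - a + 1) div 2 in
     \<Sum>j<h. (weight \<rho> h j - weight \<rho> h (Suc j)) * (x (e - j) - x (a + j)))"

section \<open>Effect of one contraction step on the spread\<close>

context
  fixes n :: nat and \<rho> :: real and C :: "nat set" and x y :: "nat \<Rightarrow> real"
  assumes step: "contraction_step n \<rho> C x y" and \<rho>: "0 < \<rho>" "\<rho> \<le> 1/2"
begin

lemma step_mono: "i \<le> j \<Longrightarrow> j < n \<Longrightarrow> x i \<le> x j"
  and step_bounded: "p \<in> C \<Longrightarrow> Suc p < n"
  and step_lower: "u \<le> i \<Longrightarrow> i < n \<Longrightarrow> left_closed C u \<Longrightarrow>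
        x u + \<rho> * (x (if i \<in> C then Suc i else i) - x u) \<le> y i"
  and step_upper: "i \<le> v \<Longrightarrow> v < n \<Longrightarrow> v \<notin> C \<Longrightarrow>
        y i \<le> x v - \<rho> * (x v - x (if left_closed C i then i else i - 1))"
  using step unfolding contraction_step_def by blast+

lemma crossed_gap_nonneg: "0 \<le> crossed_gap C x p"
  using step_bounded[of p] step_mono[of p "Suc p"] by (auto simp: crossed_gap_def gap_def)

text \<open>The witness is the bottom of the block of \<open>a + j\<close>: across a crossed gap the
  bottom is inherited, above an uncrossed one a new block starts.\<close>

lemma block_start:
  assumes a: "left_closed C a" and "a + j < n"
  shows "\<exists>u\<ge>a. u \<le> a + j \<and> left_closed C u \<and> x (a + j) - x u \<le> (\<Sum>l<j. crossed_gap C x (a + l))"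
  using assms(2)
proof (induction j)
  case 0
  show ?case using a by (intro exI[of _ a]) auto
next
  case (Suc j)
  show ?case
  proof (cases "a + j \<in> C")
    case True
    obtain u where "a \<le> u" "u \<le> a + j" "left_closed C u"
        "x (a + j) - x u \<le> (\<Sum>l<j. crossed_gap C x (a + l))"
      using Suc by auto
    then show ?thesis
      using True by (intro exI[of _ u]) (auto simp: crossed_gap_def gap_def)
  next
    case False
    then show ?thesis
      by (intro exI[of _ "a + Suc j"])
        (auto simp: left_closed_def intro!: add_nonneg_nonneg sum_nonneg crossed_gap_nonneg)
  qed
qed

lemma block_end:
  assumes e: "e \<notin> C" "e < n" and "j \<le> e"
  shows "\<exists>v\<le>e. e - j \<le> v \<and> v \<notin> C \<and> x v - x (e - j) \<le> (\<Sum>l<j. crossed_gap C x (e - Suc l))"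
  using assms(3)
proof (induction j)
  case 0
  show ?case using e by (intro exI[of _ e]) auto
next
  case (Suc j)
  have S: "Suc (e - Suc j) = e - j" using Suc.prems by auto
  show ?case
  proof (cases "e - Suc j \<in> C")
    case True
    obtain v where "v \<le> e" "e - j \<le> v" "v \<notin> C"
        "x v - x (e - j) \<le> (\<Sum>l<j. crossed_gap C x (e - Suc l))"
      using Suc by auto
    then show ?thesis
      using True S by (intro exI[of _ v]) (auto simp: crossed_gap_def gap_def)
  next
    case False
    then show ?thesis
      by (intro exI[of _ "e - Suc j"])
        (auto intro!: add_nonneg_nonneg sum_nonneg crossed_gap_nonneg)
  qed
qed

text \<open>Measured from the bottom of its block, the agent may lose \<open>1 - \<rho>\<close> of
  its height, but it earns a \<open>\<rho>\<close>-fraction of the crossed gap above it. The height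
  consists of crossed gaps nearer to \<open>a\<close>.\<close>

lemma lower_gain:
  assumes "left_closed C a" "a + j < n"
  shows "\<rho> * crossed_gap C x (a + j) - (1 - \<rho>) * (\<Sum>l<j. crossed_gap C x (a + l))
         \<le> y (a + j) - x (a + j)"
proof -
  obtain u where u: "u \<le> a + j" "left_closed C u"
      "x (a + j) - x u \<le> (\<Sum>l<j. crossed_gap C x (a + l))"
    using block_start[OF assms] by auto
  have "x u + \<rho> * (x (a + j) + crossed_gap C x (a + j) - x u) \<le> y (a + j)"
    using step_lower[OF u(1) assms(2) u(2)] by (auto simp: crossed_gap_def gap_def split: if_splits)
  moreover have "(1 - \<rho>) * (x (a + j) - x u) \<le> (1 - \<rho>) * (\<Sum>l<j. crossed_gap C x (a + l))"
    using u(3) \<rho> by (intro mult_left_mono) auto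
  ultimately show ?thesis by (simp add: algebra_simps)
qed

lemma upper_gain:
  assumes "e \<notin> C" "e < n" "j < e"
  shows "\<rho> * crossed_gap C x (e - Suc j) - (1 - \<rho>) * (\<Sum>l<j. crossed_gap C x (e - Suc l))
         \<le> x (e - j) - y (e - j)"
proof -
  obtain v where v: "v \<le> e" "e - j \<le> v" "v \<notin> C"
      "x v - x (e - j) \<le> (\<Sum>l<j. crossed_gap C x (e - Suc l))"
    using block_end[OF assms(1,2), of j] assms(3) by auto
  have S: "Suc (e - Suc j) = e - j" using assms by auto
  have "left_closed C (e - j) \<longleftrightarrow> e - Suc j \<notin> C"
    using S by (auto simp: left_closed_def) (metis Suc_inject)
  moreover have "y (e - j) \<le> x v - \<rho> * (x v - x (if left_closed C (e - j) then e - j else e - j - 1))"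
    using step_upper[OF v(2) _ v(3)] v(1) assms by auto
  ultimately have "y (e - j) \<le> x v - \<rho> * (x v - (x (e - j) - crossed_gap C x (e - Suc j)))"
    using S by (auto simp: crossed_gap_def gap_def)
  moreover have "(1 - \<rho>) * (x v - x (e - j)) \<le> (1 - \<rho>) * (\<Sum>l<j. crossed_gap C x (e - Suc l))"
    using v(4) \<rho> by (intro mult_left_mono) auto
  ultimately show ?thesis by (simp add: algebra_simps)
qed

text \<open>The inward motions at the low ranks and at the high ranks are two separate instances of
  \<open>weighted_gain\<close>.\<close>

lemma spread_drop:
  assumes a: "left_closed C a" and e: "e \<notin> C" "e < n" and "a < e"
  defines "h \<equiv> (e - a + 1) div 2"
  shows "(\<Sum>j<h. \<rho> ^ Suc j / real h * (crossed_gap C x (a + j) + crossed_gap C x (e - Suc j)))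
         \<le> spread \<rho> a e x - spread \<rho> a e y"
proof -
  have h: "0 < h" and hj: "\<And>j. j < h \<Longrightarrow> a + j < n \<and> j < e"
    using assms by (auto simp: h_def)
  have "(\<Sum>j<h. \<rho> ^ Suc j / real h * crossed_gap C x (a + j))
        \<le> (\<Sum>j<h. (weight \<rho> h j - weight \<rho> h (Suc j)) * (y (a + j) - x (a + j)))"
    using \<rho> h hj lower_gain[OF a] by (intro weighted_gain) auto
  moreover have "(\<Sum>j<h. \<rho> ^ Suc j / real h * crossed_gap C x (e - Suc j))
        \<le> (\<Sum>j<h. (weight \<rho> h j - weight \<rho> h (Suc j)) * (x (e - j) - y (e - j)))"
    using \<rho> h hj upper_gain[OF e] by (intro weighted_gain) auto
  moreover have "spread \<rho> a e x - spread \<rho> a e y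
      = (\<Sum>j<h. (weight \<rho> h j - weight \<rho> h (Suc j)) * (y (a + j) - x (a + j)))
      + (\<Sum>j<h. (weight \<rho> h j - weight \<rho> h (Suc j)) * (x (e - j) - y (e - j)))"
    unfolding spread_def Let_def h_def[symmetric]
    by (simp add: algebra_simps flip: sum.distrib sum_subtractf)
  ultimately show ?thesis
    by (simp add: distrib_left sum.distrib)
qed

lemma spread_drop_gap:
  assumes "left_closed C a" "e \<notin> C" "e < n" and p: "p \<in> C" "a \<le> p" "p < e"
  shows "\<rho> ^ (min (p - a + 1) (e - p)) / real ((e - a + 1) div 2) * gap x p
         \<le> spread \<rho> a e x - spread \<rho> a e y"
proof -
  define h where "h = (e - a + 1) div 2"
  define F where "F j = \<rho> ^ Suc j / real h * (crossed_gap C x (a + j) + crossed_gap C x (e - Suc j))" for j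
  \<comment> \<open>The rank from the nearer end, counted from 0, whereas the \<open>min\<close> in
    the statement counts from 1; hence the exponent \<open>Suc k\<close> in
    \<open>F k\<close>.\<close>
  define k where "k = min (p - a + 1) (e - p) - 1"
  have k: "k < h" "min (p - a + 1) (e - p) = Suc k" "p = a + k \<or> p = e - Suc k"
    using p by (auto simp: h_def k_def min_def)
  have F0: "0 \<le> F j" for j
    unfolding F_def using \<rho> crossed_gap_nonneg by (intro mult_nonneg_nonneg add_nonneg_nonneg) auto
  have "gap x p = crossed_gap C x p" using p by (simp add: crossed_gap_def)
  also have "\<dots> \<le> crossed_gap C x (a + k) + crossed_gap C x (e - Suc k)"
    using k(3) crossed_gap_nonneg[of "a + k"] crossed_gap_nonneg[of "e - Suc k"] by auto
  finally have "\<rho> ^ Suc k / real h * gap x p \<le> F k"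
    unfolding F_def using \<rho> by (intro mult_left_mono) auto
  also have "F k \<le> (\<Sum>j<h. F j)"
    using k F0 by (intro member_le_sum) auto
  also have "\<dots> \<le> spread \<rho> a e x - spread \<rho> a e y"
    using spread_drop[of a e] assms by (simp add: F_def h_def)
  finally show ?thesis unfolding k(2) h_def .
qed

lemma spread_drop_total:
  assumes "left_closed C a" "e \<notin> C" "e < n" "a < e"
  defines "h \<equiv> (e - a + 1) div 2"
  shows "\<rho> ^ h / real h * (\<Sum>p\<in>C \<inter> {a..<e}. gap x p) \<le> spread \<rho> a e x - spread \<rho> a e y"
proof -
  let ?f = "crossed_gap C x"
  \<comment> \<open>The \<open>h\<close> lowest and the \<open>h\<close> highest gaps cover the
    interval. They share the middle gap when \<open>e - a\<close> is odd, which only enlarges the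
    sum.\<close>
  define A where "A = (\<lambda>j. a + j) ` {..<h}"
  define B where "B = (\<lambda>j. e - Suc j) ` {..<h}"
  have sub: "{a..<e} \<subseteq> A \<union> B"
  proof
    fix p assume p: "p \<in> {a..<e}"
    show "p \<in> A \<union> B"
    proof (cases "p - a < h")
      case True
      then show ?thesis using p by (auto simp: A_def image_iff intro!: bexI[of _ "p - a"])
    next
      case False
      then have "e - Suc p < h" using p by (auto simp: h_def)
      then show ?thesis using p by (auto simp: B_def image_iff intro!: bexI[of _ "e - Suc p"])
    qed
  qed
  have fin: "finite A" "finite B" by (auto simp: A_def B_def)
  have "(\<Sum>p\<in>C \<inter> {a..<e}. gap x p) = (\<Sum>p\<in>{a..<e}. ?f p)"
    by (simp add: crossed_gap_def sum.If_cases Int_commute)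
  also have "\<dots> \<le> (\<Sum>p\<in>A \<union> B. ?f p)"
    using sub fin crossed_gap_nonneg by (intro sum_mono2) auto
  also have "\<dots> \<le> (\<Sum>p\<in>A. ?f p) + (\<Sum>p\<in>B. ?f p)"
    using fin crossed_gap_nonneg by (simp add: sum_Un sum_nonneg)
  also have "(\<Sum>p\<in>A. ?f p) = (\<Sum>j<h. ?f (a + j))"
    unfolding A_def by (subst sum.reindex) auto
  also have "(\<Sum>p\<in>B. ?f p) = (\<Sum>j<h. ?f (e - Suc j))"
    unfolding B_def by (subst sum.reindex) (auto simp: inj_on_def h_def)
  finally have "\<rho> ^ h / real h * (\<Sum>p\<in>C \<inter> {a..<e}. gap x p)
      \<le> \<rho> ^ h / real h * ((\<Sum>j<h. ?f (a + j)) + (\<Sum>j<h. ?f (e - Suc j)))"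
    using \<rho> by (intro mult_left_mono) auto
  also have "\<dots> = (\<Sum>j<h. \<rho> ^ h / real h * (?f (a + j) + ?f (e - Suc j)))"
    by (simp add: sum_distrib_left distrib_left flip: sum.distrib)
  also have "\<dots> \<le> (\<Sum>j<h. \<rho> ^ Suc j / real h * (?f (a + j) + ?f (e - Suc j)))"
    using \<rho> crossed_gap_nonneg
    by (intro sum_mono mult_right_mono divide_right_mono power_decreasing add_nonneg_nonneg) auto
  also have "\<dots> \<le> spread \<rho> a e x - spread \<rho> a e y"
    using spread_drop[of a e] assms(1-4) by (simp add: h_def)
  finally show ?thesis .
qed

lemma spread_antimono:
  assumes "left_closed C a" "e \<notin> C" "e < n" "a < e"
  shows "spread \<rho> a e y \<le> spread \<rho> a e x"
proof -
  have "0 \<le> \<rho> ^ ((e - a + 1) div 2) / real ((e - a + 1) div 2) * (\<Sum>p\<in>C \<inter> {a..<e}. gap x p)"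
    using \<rho> step_mono step_bounded
    by (intro mult_nonneg_nonneg sum_nonneg) (auto simp: gap_def)
  then show ?thesis using spread_drop_total[OF assms] by linarith
qed

lemma spread_nonneg:
  assumes "e < n"
  shows "0 \<le> spread \<rho> a e x"
  unfolding spread_def Let_def using assms \<rho> weight_Suc_le step_mono
  by (intro sum_nonneg mult_nonneg_nonneg) auto

lemma spread_le:
  assumes "e < n" "a < e"
  shows "spread \<rho> a e x \<le> x e - x a"
proof -
  define h where "h = (e - a + 1) div 2"
  have h: "0 < h" using assms by (auto simp: h_def)
  have "spread \<rho> a e x \<le> (\<Sum>j<h. (weight \<rho> h j - weight \<rho> h (Suc j)) * (x e - x a))"
    unfolding spread_def Let_def h_def[symmetric]
  proof (intro sum_mono mult_left_mono)
    fix j assume "j \<in> {..<h}"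
    then have "x (e - j) \<le> x e" "x a \<le> x (a + j)"
      using assms step_mono by (auto simp: h_def)
    then show "x (e - j) - x (a + j) \<le> x e - x a" by simp
  qed (use \<rho> weight_Suc_le in auto)
  also have "\<dots> = x e - x a"
    using sum_lessThan_telescope'[of "weight \<rho> h" h] weight_ends h
    by (simp flip: sum_distrib_right)
  finally show ?thesis .
qed

lemma left_closed_mono: "left_closed C a \<Longrightarrow> a < n \<Longrightarrow> x a \<le> y a"
  using lower_gain[of a 0] mult_nonneg_nonneg[OF less_imp_le[OF \<rho>(1)] crossed_gap_nonneg[of a]]
  by simp

lemma not_crossed_antimono: 
  assumes "e \<notin> C" "e < n"
  shows "y e \<le> x e"
proof -
  have "x (if left_closed C e then e else e - 1) \<le> x e"
    using assms by (auto intro!: step_mono)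
  then have "0 \<le> \<rho> * (x e - x (if left_closed C e then e else e - 1))"
    using \<rho> by simp
  then show ?thesis using step_upper[of e e] assms by auto
qed

end

section \<open>Energy of a sorted system\<close>

text \<open>Absorbs the number of gaps of an interval into the powers of
  \<open>1/\<rho> \<ge> 2\<close> that are left beyond the middle rank.\<close>

lemma le_two_power_half:
  assumes "h = Suc k div 2"
  shows "Suc k \<le> 2 * 2 ^ (k - h)"
proof -
  have "k - h < 2 ^ (k - h)" by simp
  then show ?thesis using assms by linarith
qed

locale contraction_system =
  fixes n :: nat and \<rho> :: real and X :: "nat \<Rightarrow> nat \<Rightarrow> real" and C :: "nat \<Rightarrow> nat set"
  assumes dyn: "\<And>t. contraction_step n \<rho> (C t) (X t) (X (Suc t))"
    and \<rho>: "0 < \<rho>" "\<rho> \<le> 1/2"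
begin

text \<open>No block reaches across either end, so the ranks from \<open>a\<close> to
  \<open>e\<close> evolve as a system of their own.\<close>

definition isolated :: "nat \<Rightarrow> nat \<Rightarrow> nat \<Rightarrow> bool" where
  "isolated a e t \<longleftrightarrow> left_closed (C t) a \<and> e \<notin> C t"

definition width :: "nat \<Rightarrow> nat \<Rightarrow> nat \<Rightarrow> real" where
  "width a e t = X t e - X t a"

text \<open>Charging crossed gaps instead of blocks dominates the block energy by subadditivity of
  the power, and it splits exactly at an uncrossed gap.\<close>

definition gap_energy :: "real \<Rightarrow> nat \<Rightarrow> nat \<Rightarrow> nat \<Rightarrow> real" where
  "gap_energy s a e t = (\<Sum>p\<in>C t \<inter> {a..<e}. gap (X t) p powr s)"

lemmas mono = step_mono[OF dyn \<rho>]

lemma width_nonneg: "a \<le> e \<Longrightarrow> e < n \<Longrightarrow> 0 \<le> width a e t"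
  using mono[of a e t] by (simp add: width_def)

lemma gap_nonneg: "Suc p < n \<Longrightarrow> 0 \<le> gap (X t) p"
  using mono[of p "Suc p" t] by (simp add: gap_def)

lemma gap_le_width: "a \<le> p \<Longrightarrow> p < e \<Longrightarrow> e < n \<Longrightarrow> gap (X t) p \<le> width a e t"
  using mono[of a p t] mono[of "Suc p" e t] by (simp add: width_def gap_def)

lemma isolated_whole: "0 < n \<Longrightarrow> isolated 0 (n - 1) t"
  using step_bounded[OF dyn \<rho>, of "n - 1" t] by (auto simp: isolated_def left_closed_def)

section \<open>Monotone quantities over time\<close>

lemma width_antimono:
  assumes "a \<le> e" "e < n" "t0 \<le> t1" "\<And>t. t0 \<le> t \<Longrightarrow> t < t1 \<Longrightarrow> isolated a e t"
  shows "width a e t1 \<le> width a e t0"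
  using assms(3,4)
proof (induction t1 rule: dec_induct)
  case (step t)
  then have "isolated a e t" by auto
  then have "width a e (Suc t) \<le> width a e t"
    using left_closed_mono[OF dyn \<rho>, of t a] not_crossed_antimono[OF dyn \<rho>, of e t] assms(1,2)
    by (simp add: width_def isolated_def)
  then show ?case using step by fastforce
qed simp

lemma spread_decreasing:
  assumes "a < e" "e < n" "t0 \<le> t1" "\<And>t. t0 \<le> t \<Longrightarrow> t < t1 \<Longrightarrow> isolated a e t"
  shows "spread \<rho> a e (X t1) \<le> spread \<rho> a e (X t0)"
  using assms(3,4)
proof (induction t1 rule: dec_induct)
  case (step t)
  then have "isolated a e t" by auto
  then have "spread \<rho> a e (X (Suc t)) \<le> spread \<rho> a e (X t)"
    using spread_antimono[OF dyn \<rho>, of t a e] assms(1,2) by (simp add: isolated_def)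
  then show ?case using step by fastforce
qed simp

text \<open>While \<open>g\<close> is uncrossed it is the top of a block and \<open>Suc g\<close>
  the bottom of one, so the former cannot rise and the latter cannot fall.\<close>

lemma uncrossed_gap_increasing:
  assumes "Suc g < n" "t0 \<le> t1" "\<And>t. t0 \<le> t \<Longrightarrow> t < t1 \<Longrightarrow> g \<notin> C t"
  shows "gap (X t0) g \<le> gap (X t1) g"
  using assms(2,3)
proof (induction t1 rule: dec_induct)
  case (step t)
  then have "g \<notin> C t" by auto
  then have "gap (X t) g \<le> gap (X (Suc t)) g"
    using left_closed_mono[OF dyn \<rho>, of t "Suc g"] not_crossed_antimono[OF dyn \<rho>, of g t] assms(1)
    by (simp add: gap_def left_closed_def)
  then show ?case using step by fastforce
qed simp

lemma gap_energy_le: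
  assumes "0 < s" "e < n"
  shows "gap_energy s a e t \<le> real (e - a) * width a e t powr s"
proof -
  have "gap_energy s a e t \<le> (\<Sum>p\<in>C t \<inter> {a..<e}. width a e t powr s)"
    unfolding gap_energy_def using assms gap_le_width gap_nonneg
    by (intro sum_mono powr_mono2) auto
  also have "\<dots> \<le> (\<Sum>p\<in>{a..<e}. width a e t powr s)"
    by (intro sum_mono2) auto
  finally show ?thesis by simp
qed

lemma gap_energy_split:
  assumes "a \<le> g" "g < e" "g \<notin> C t"
  shows "gap_energy s a e t = gap_energy s a g t + gap_energy s (Suc g) e t"
proof -
  have "C t \<inter> {a..<e} = (C t \<inter> {a..<g}) \<union> (C t \<inter> {Suc g..<e})"
    using assms by (auto simp: less_Suc_eq_le) (metis Suc_leI le_neq_implies_less not_less)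
  then show ?thesis
    unfolding gap_energy_def by (metis (no_types, lifting) sum.union_disjoint finite_Int
        finite_atLeastLessThan disjoint_iff IntD2 atLeastLessThan_iff Suc_leD not_less)
qed

section \<open>The 1-energy by telescoping the spread\<close>

lemma total_crossed_gaps:
  assumes "2 \<le> n"
  shows "(\<Sum>t<T. \<Sum>p\<in>C t. gap (X t) p)
         \<le> real (n div 2) * (1/\<rho>) ^ (n div 2) * width 0 (n - 1) 0"
proof -
  define h where "h = n div 2"
  have h: "0 < h" "(n - 1 - 0 + 1) div 2 = h" using assms by (auto simp: h_def)
  have CI: "C t \<inter> {0..<n - 1} = C t" for t
    using step_bounded[OF dyn \<rho>, of _ t] by fastforce
  have drop: "\<rho> ^ h / real h * (\<Sum>p\<in>C t. gap (X t) p)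
      \<le> spread \<rho> 0 (n - 1) (X t) - spread \<rho> 0 (n - 1) (X (Suc t))" for t
    using spread_drop_total[OF dyn \<rho>, of t 0 "n - 1"] isolated_whole[of t] assms
    unfolding h(2) CI by (auto simp: isolated_def)
  have "\<rho> ^ h / real h * (\<Sum>t<T. \<Sum>p\<in>C t. gap (X t) p)
      = (\<Sum>t<T. \<rho> ^ h / real h * (\<Sum>p\<in>C t. gap (X t) p))"
    by (simp add: sum_distrib_left)
  also have "\<dots> \<le> (\<Sum>t<T. spread \<rho> 0 (n - 1) (X t) - spread \<rho> 0 (n - 1) (X (Suc t)))"
    by (intro sum_mono drop)
  also have "\<dots> = spread \<rho> 0 (n - 1) (X 0) - spread \<rho> 0 (n - 1) (X T)"
    by (rule sum_lessThan_telescope')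
  also have "\<dots> \<le> width 0 (n - 1) 0"
    using spread_le[OF dyn \<rho>, of "n - 1" 0 0] spread_nonneg[OF dyn \<rho>, of "n - 1" 0 T] assms
    by (simp add: width_def)
  finally have "\<rho> ^ h * (\<Sum>t<T. \<Sum>p\<in>C t. gap (X t) p) \<le> real h * width 0 (n - 1) 0"
    using h by (simp add: field_simps)
  then show ?thesis
    using \<rho> by (simp add: h_def field_simps)
qed

text \<open>By \<open>few\<close>, at most \<open>m\<close> gaps are uncrossed; being small,
  together they make up at most half of the width.\<close>

lemma crossed_sum_ge_half:
  assumes ae: "a < e" "e < n" and few: "e - a < Suc m + card (C t \<inter> {a..<e})"
    and small: "\<And>p. a \<le> p \<Longrightarrow> p < e \<Longrightarrow> gap (X t) p \<le> width a e t / (2 * real (Suc m))"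
  shows "width a e t / 2 \<le> (\<Sum>p\<in>C t \<inter> {a..<e}. gap (X t) p)"
proof -
  let ?D = "width a e t" and ?U = "{a..<e} - C t"
  have "card ?U = e - a - card (C t \<inter> {a..<e})"
    by (simp add: card_Diff_subset_Int Int_commute)
  then have cU: "card ?U \<le> m" using few by linarith
  have "(\<Sum>p\<in>?U. gap (X t) p) \<le> (\<Sum>p\<in>?U. ?D / (2 * real (Suc m)))"
    using small by (intro sum_mono) auto
  also have "\<dots> = real (card ?U) * (?D / (2 * real (Suc m)))" by simp
  also have "\<dots> \<le> real (Suc m) * (?D / (2 * real (Suc m)))"
    using cU width_nonneg[of a e t] ae by (intro mult_right_mono) auto
  also have "\<dots> = ?D / 2"
    by (simp add: field_simps del: of_nat_Suc)
  finally have "(\<Sum>p\<in>?U. gap (X t) p) \<le> ?D / 2" .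
  moreover have "?D = (\<Sum>p\<in>{a..<e}. gap (X t) p)"
    using sum_Suc_diff'[of a e "X t"] ae by (simp add: width_def gap_def)
  moreover have "\<dots> = (\<Sum>p\<in>C t \<inter> {a..<e}. gap (X t) p) + (\<Sum>p\<in>?U. gap (X t) p)"
    using sum.Int_Diff[of "{a..<e}" "gap (X t)" "C t"] by (simp add: Int_commute)
  ultimately show ?thesis by linarith
qed

text \<open>Here \<open>E\<close> is the energy of the times from \<open>t0\<close> to \<open>t\<close>, the last of which is the only one at
  which the spread is known to drop.\<close>

lemma phase_payment:
  assumes s: "0 < s" "s \<le> 1" and ae: "a < e" "e < n" and D: "0 < width a e t0" and t: "t0 \<le> t"
    and iso: "\<And>t'. t0 \<le> t' \<Longrightarrow> t' \<le> t \<Longrightarrow> isolated a e t'"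
    and \<eta>: "0 < \<eta>"
    and drop: "\<eta> * width a e t0 \<le> spread \<rho> a e (X t) - spread \<rho> a e (X (Suc t))"
    and cost: "E \<le> c * width a e t0 powr s" and K: "0 \<le> K" "c \<le> K * (s * \<eta>)"
  shows "E + K * spread \<rho> a e (X (Suc t)) powr s \<le> K * spread \<rho> a e (X t0) powr s"
proof -
  let ?V = "\<lambda>t. spread \<rho> a e (X t)"
  have "?V t \<le> ?V t0"
    using ae t iso by (intro spread_decreasing) auto
  moreover have "?V t0 \<le> width a e t0"
    using spread_le[OF dyn \<rho>] ae by (simp add: width_def)
  moreover have "0 \<le> ?V (Suc t)"
    using spread_nonneg[OF dyn \<rho>] ae by simp
  ultimately have "?V (Suc t) powr s + s * \<eta> * width a e t0 powr s \<le> ?V t0 powr s"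
    using drop D s \<eta> by (intro powr_drop) auto
  then have "K * (?V (Suc t) powr s + s * \<eta> * width a e t0 powr s) \<le> K * ?V t0 powr s"
    using K by (intro mult_left_mono)
  moreover have "E \<le> K * (s * \<eta>) * width a e t0 powr s"
    using cost K(2) by (smt (verit) mult_right_mono powr_ge_zero)
  ultimately show ?thesis by (simp add: algebra_simps)
qed

text \<open>The time range is cut into phases. The term with \<open>K\<close> pays for each phase
  that ends in a drop of the spread; the term with \<open>R\<close> pays once for a last phase
  without such a drop. The induction runs over the remaining time.\<close>

lemma energy_bound_step:
  fixes m :: nat and s \<beta> :: real
  assumes s: "0 < s" "s \<le> 1" and \<beta>: "0 \<le> \<beta>"
    and IH: "\<And>a e t0 t1. \<lbrakk>a \<le> e; e < n;
        \<And>t. t0 \<le> t \<Longrightarrow> t < t1 \<Longrightarrow> isolated a e t \<and> e - a < m + card (C t \<inter> {a..<e})\<rbrakk>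
      \<Longrightarrow> (\<Sum>t=t0..<t1. gap_energy s a e t) \<le> \<beta> * (1/\<rho>) ^ (e - a) * width a e t0 powr s"
    and ae: "a < e" "e < n"
    and iso: "\<And>t. t0 \<le> t \<Longrightarrow> t < t1 \<Longrightarrow>
          isolated a e t \<and> e - a < Suc m + card (C t \<inter> {a..<e})"
  defines "K \<equiv> 2 * real (Suc m) * real n / s * (\<beta> + 1) * (1/\<rho>) ^ (e - a)"
    and "R \<equiv> 2 * (\<beta> + 1) * (1/\<rho>) ^ (e - a)"
  shows "(\<Sum>t=t0..<t1. gap_energy s a e t)
         \<le> K * spread \<rho> a e (X t0) powr s + R * width a e t0 powr s"
  using iso
proof (induction "t1 - t0" arbitrary: t0 rule: less_induct)
  case less
  define r where "r = 1 / \<rho>"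
  have r: "2 \<le> r" "r * \<rho> = 1" using \<rho> by (auto simp: r_def field_simps)
  define h where "h = Suc (e - a) div 2"
  have h: "0 < h" "h \<le> e - a" "2 * h \<le> n" using ae by (auto simp: h_def)
  have rpow: "r ^ (e - a) * \<rho> ^ k = r ^ (e - a - k)" if "k \<le> e - a" for k
  proof -
    have "r ^ (e - a) = r ^ (e - a - k) * r ^ k"
      using le_add_diff_inverse2[OF that] by (metis power_add)
    then show ?thesis using r by (simp add: mult.assoc flip: power_mult_distrib)
  qed
  \<comment> \<open>A single time step has energy at most the number of gaps times the power of the
    width, so this lets one step fit into the cost of a phase.\<close>
  have size: "real (e - a) \<le> 2 * r ^ (e - a - k)" if "k \<le> h" for k
  proof -
    have "real (e - a) \<le> real (2 * 2 ^ (e - a - h))"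
      using le_two_power_half[of h "e - a"] unfolding of_nat_le_iff by (simp add: h_def)
    also have "\<dots> \<le> 2 * r ^ (e - a - h)"
      using r by (simp add: power_mono)
    also have "\<dots> \<le> 2 * r ^ (e - a - k)"
      using r that by (intro mult_left_mono power_increasing) auto
    finally show ?thesis .
  qed
  have K0: "0 \<le> K" and R0: "0 \<le> R" using s \<beta> \<rho> by (auto simp: K_def R_def)
  \<comment> \<open>The payment for a drop of relative size \<open>\<rho> ^ k / h * z\<close>. The
    factor \<open>n\<close> in \<open>K\<close> outweighs \<open>h\<close>, since
    \<open>2 * h \<le> n\<close>.\<close>
  have Ks: "K * (s * (\<rho> ^ k / real h * z)) = 2 * real (Suc m) * real n / real h * z * (\<beta> + 1) * r ^ (e - a - k)"
    if "k \<le> h" for k z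
    using rpow[of k] that h s unfolding K_def r_def[symmetric] by (simp add: field_simps)
  let ?D = "\<lambda>t. width a e t" and ?V = "\<lambda>t. spread \<rho> a e (X t)"
  have D0: "0 \<le> ?D t0" using width_nonneg ae by simp
  have Dle: "?D t \<le> ?D t0" if "t0 \<le> t" "t \<le> t1" for t
    using that less.prems ae by (intro width_antimono) auto
  have nodrop: "(\<Sum>t=t0..<t1. gap_energy s a e t) \<le> K * ?V t0 powr s + R * ?D t0 powr s"
    if "(\<Sum>t=t0..<t1. gap_energy s a e t) \<le> R * ?D t0 powr s"
    using that K0 by (smt (verit) mult_nonneg_nonneg powr_ge_zero)
  \<comment> \<open>A paid phase can be put in front of the bound for the remaining times. The width
    does not grow, so the term with \<open>R\<close> is not charged anew.\<close>
  have finish: "(\<Sum>t=t0..<t1. gap_energy s a e t) \<le> K * ?V t0 powr s + R * ?D t0 powr s"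
    if \<tau>: "t0 \<le> \<tau>" "\<tau> < t1"
      and pay: "(\<Sum>t=t0..<Suc \<tau>. gap_energy s a e t) + K * ?V (Suc \<tau>) powr s \<le> K * ?V t0 powr s" for \<tau>
  proof -
    have "(\<Sum>t=Suc \<tau>..<t1. gap_energy s a e t) \<le> K * ?V (Suc \<tau>) powr s + R * ?D (Suc \<tau>) powr s"
      using \<tau> less.prems by (intro less.hyps) auto
    moreover have "R * ?D (Suc \<tau>) powr s \<le> R * ?D t0 powr s"
      using \<tau> R0 s Dle[of "Suc \<tau>"] width_nonneg[of a e "Suc \<tau>"] ae
      by (intro mult_left_mono powr_mono2) auto
    moreover have "(\<Sum>t=t0..<t1. gap_energy s a e t)
        = (\<Sum>t=t0..<Suc \<tau>. gap_energy s a e t) + (\<Sum>t=Suc \<tau>..<t1. gap_energy s a e t)"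
      using \<tau> by (intro sum.atLeastLessThan_concat[symmetric]) auto
    ultimately show ?thesis using pay by linarith
  qed
  consider "t1 \<le> t0 \<or> ?D t0 = 0"
    | (small) "t0 < t1" "0 < ?D t0" "\<forall>p. a \<le> p \<longrightarrow> p < e \<longrightarrow> gap (X t0) p \<le> ?D t0 / (2 * real (Suc m))"
    | (large) g where "0 < ?D t0" "a \<le> g" "g < e" "?D t0 / (2 * real (Suc m)) \<le> gap (X t0) g"
    using D0 by (meson less_eq_real_def linorder_not_less)
  then show ?case
  proof cases
    case 1
    have "gap_energy s a e t \<le> 0" if "t0 \<le> t" "t < t1" for t
    proof -
      have "?D t = 0" using 1 that Dle[of t] width_nonneg[of a e t] ae by auto
      then show ?thesis using gap_energy_le[of s e a t] s ae by simp
    qed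
    then have "(\<Sum>t=t0..<t1. gap_energy s a e t) \<le> 0"
      by (intro sum_nonpos) auto
    then show ?thesis
      using R0 by (intro nodrop) (smt (verit) mult_nonneg_nonneg powr_ge_zero)
  next
    case small
    \<comment> \<open>At most \<open>m\<close> gaps are uncrossed, so half of the width is crossed at once.\<close>
    have "\<rho> ^ h / real h * (1/2) * ?D t0 = \<rho> ^ h / real h * (?D t0 / 2)" by simp
    also have "\<dots> \<le> \<rho> ^ h / real h * (\<Sum>p\<in>C t0 \<inter> {a..<e}. gap (X t0) p)"
      using small ae less.prems[of t0] \<rho> by (intro mult_left_mono crossed_sum_ge_half) auto
    also have "\<dots> \<le> ?V t0 - ?V (Suc t0)"
      using spread_drop_total[OF dyn \<rho>, of t0 a e] less.prems[of t0] small ae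
      by (simp add: h_def isolated_def)
    finally have drop: "\<rho> ^ h / real h * (1/2) * ?D t0 \<le> ?V t0 - ?V (Suc t0)" .
    have "real (e - a) \<le> 2 * 1 * r ^ (e - a - h)" using size[of h] by simp
    also have "\<dots> \<le> 2 * real (Suc m) * real n / real h * (1/2) * (\<beta> + 1) * r ^ (e - a - h)"
    proof (intro mult_right_mono)
      have "1 * (2 * real h) * 1 \<le> real (Suc m) * real n * (\<beta> + 1)"
        using h \<beta> by (intro mult_mono) auto
      then show "2 * 1 \<le> 2 * real (Suc m) * real n / real h * (1/2) * (\<beta> + 1)"
        using h by (simp add: field_simps)
    qed (use r in auto)
    also have "\<dots> = K * (s * (\<rho> ^ h / real h * (1/2)))"
      using Ks[OF order_refl, of "1/2"] by (rule sym)
    finally have "gap_energy s a e t0 + K * ?V (Suc t0) powr s \<le> K * ?V t0 powr s"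
      using \<rho> h less.prems small
      by (intro phase_payment[OF s ae small(2) order_refl _ _ drop gap_energy_le[OF s(1) ae(2)] K0]) auto
    then show ?thesis using small by (intro finish[of t0]) auto
  next
    case large
    \<comment> \<open>Until \<open>g\<close> is crossed the two sides evolve independently with at most \<open>m\<close> blocks each.\<close>
    define \<kappa> where "\<kappa> = min (g - a + 1) (e - g)"
    have \<kappa>: "\<kappa> \<le> h" "g - a \<le> e - a - \<kappa>" "e - Suc g \<le> e - a - \<kappa>"
      using large(2,3) by (auto simp: \<kappa>_def h_def min_def)
    have phase: "(\<Sum>t=t0..<\<tau>. gap_energy s a e t) \<le> 2 * \<beta> * r ^ (e - a - \<kappa>) * ?D t0 powr s"
      if \<tau>: "\<tau> \<le> t1" "\<And>t. t0 \<le> t \<Longrightarrow> t < \<tau> \<Longrightarrow> g \<notin> C t" for \<tau>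
    proof -
      have side: "(\<Sum>t=t0..<\<tau>. gap_energy s a' e' t) \<le> \<beta> * r ^ (e - a - \<kappa>) * ?D t0 powr s"
        if ae': "a' = a \<and> e' = g \<or> a' = Suc g \<and> e' = e" for a' e'
      proof -
        have le: "a \<le> a'" "a' \<le> e'" "e' \<le> e" "e' - a' \<le> e - a - \<kappa>"
          using ae' large \<kappa> by auto
        have few: "isolated a' e' t \<and> e' - a' < m + card (C t \<inter> {a'..<e'})" if t: "t0 \<le> t" "t < \<tau>" for t
        proof -
          have g: "g \<notin> C t" and iso: "isolated a e t" and c: "e - a < Suc m + card (C t \<inter> {a..<e})"
            using t \<tau> less.prems by auto
          \<comment> \<open>The uncrossed gap \<open>g\<close> belongs to neither side, so each side
            has at least one uncrossed gap fewer than the whole interval: \<open>Suc m\<close>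
            becomes \<open>m\<close>.\<close>
          have "card (C t \<inter> {a..<e}) \<le> card ((C t \<inter> {a'..<e'}) \<union> ({a..<e} - {a'..<e'} - {g}))"
            using g by (intro card_mono) auto
          also have "\<dots> \<le> card (C t \<inter> {a'..<e'}) + card ({a..<e} - {a'..<e'} - {g})"
            by (rule card_Un_le)
          also have "card ({a..<e} - {a'..<e'} - {g}) = (e - a) - (e' - a') - 1"
            using ae' large by (auto simp: card_Diff_subset)
          finally have "e' - a' < m + card (C t \<inter> {a'..<e'})"
            using c le ae' large by linarith
          then show ?thesis
            using ae' g iso by (auto simp: isolated_def left_closed_def)
        qed
        have "(\<Sum>t=t0..<\<tau>. gap_energy s a' e' t) \<le> \<beta> * r ^ (e' - a') * width a' e' t0 powr s"
          unfolding r_def using le ae few by (intro IH) auto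
        also have "\<dots> \<le> \<beta> * r ^ (e - a - \<kappa>) * ?D t0 powr s"
        proof (intro mult_mono mult_left_mono power_increasing powr_mono2)
          show "width a' e' t0 \<le> ?D t0"
            using mono[of a a' t0] mono[of e' e t0] le ae by (simp add: width_def)
          show "0 \<le> width a' e' t0" using le ae by (intro width_nonneg) auto
        qed (use r \<beta> s le in auto)
        finally show ?thesis .
      qed
      have "(\<Sum>t=t0..<\<tau>. gap_energy s a e t)
          = (\<Sum>t=t0..<\<tau>. gap_energy s a g t) + (\<Sum>t=t0..<\<tau>. gap_energy s (Suc g) e t)"
        using gap_energy_split[of a g e] large \<tau> by (simp flip: sum.distrib)
      then show ?thesis using side[of a g] side[of "Suc g" e] by simp
    qed
    show ?thesis
    proof (cases "\<exists>t\<ge>t0. t < t1 \<and> g \<in> C t")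
      case False
      then have "(\<Sum>t=t0..<t1. gap_energy s a e t) \<le> 2 * \<beta> * r ^ (e - a - \<kappa>) * ?D t0 powr s"
        by (intro phase) auto
      also have "\<dots> \<le> R * ?D t0 powr s"
        unfolding R_def r_def[symmetric] using r \<beta>
        by (intro mult_right_mono mult_mono power_increasing) auto
      finally show ?thesis by (rule nodrop)
    next
      case True
      \<comment> \<open>The first crossing of \<open>g\<close>. Up to then the gap has not shrunk,
        so the drop at \<open>\<tau>\<close> can be measured against the width at
        \<open>t0\<close>.\<close>
      define \<tau> where "\<tau> = (LEAST t. t0 \<le> t \<and> g \<in> C t)"
      have \<tau>: "t0 \<le> \<tau>" "g \<in> C \<tau>" "\<tau> < t1"
        using LeastI_ex[of "\<lambda>t. t0 \<le> t \<and> g \<in> C t"] Least_le[of "\<lambda>t. t0 \<le> t \<and> g \<in> C t"] True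
        unfolding \<tau>_def by (blast, blast, metis le_less_trans)
      have before: "g \<notin> C t" if "t0 \<le> t" "t < \<tau>" for t
        using not_less_Least[of t "\<lambda>t. t0 \<le> t \<and> g \<in> C t"] that by (auto simp: \<tau>_def)
      have "\<rho> ^ \<kappa> / real h * (1 / (2 * real (Suc m))) * ?D t0
          \<le> \<rho> ^ \<kappa> / real h * gap (X t0) g"
        using large \<rho> mult_left_mono[of "?D t0 / (2 * real (Suc m))" "gap (X t0) g" "\<rho> ^ \<kappa> / real h"] by simp
      also have "\<dots> \<le> \<rho> ^ \<kappa> / real h * gap (X \<tau>) g"
        using large ae \<rho> before \<tau> by (intro mult_left_mono uncrossed_gap_increasing) auto
      also have "\<dots> \<le> ?V \<tau> - ?V (Suc \<tau>)"
        using spread_drop_gap[OF dyn \<rho>, of \<tau> a e g] less.prems[of \<tau>] \<tau> large ae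
        by (simp add: \<kappa>_def h_def isolated_def)
      finally have drop: "\<rho> ^ \<kappa> / real h * (1 / (2 * real (Suc m))) * ?D t0 \<le> ?V \<tau> - ?V (Suc \<tau>)" .
      \<comment> \<open>At \<open>\<tau>\<close> itself the two sides interact and the induction
        hypothesis is silent; this single step accounts for the 1 in
        \<open>\<beta> + 1\<close>.\<close>
      have "gap_energy s a e \<tau> \<le> real (e - a) * ?D \<tau> powr s"
        using s ae by (intro gap_energy_le)
      also have "\<dots> \<le> 2 * r ^ (e - a - \<kappa>) * ?D t0 powr s"
        using size[OF \<kappa>(1)] Dle[of \<tau>] \<tau> s width_nonneg[of a e \<tau>] ae r
        by (intro mult_mono powr_mono2) auto
      finally have "(\<Sum>t=t0..<Suc \<tau>. gap_energy s a e t)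
          \<le> 2 * (\<beta> + 1) * r ^ (e - a - \<kappa>) * ?D t0 powr s"
        using phase[of \<tau>] \<tau> before by (simp add: algebra_simps)
      moreover have "2 * (\<beta> + 1) * r ^ (e - a - \<kappa>)
          \<le> K * (s * (\<rho> ^ \<kappa> / real h * (1 / (2 * real (Suc m)))))"
      proof -
        have "2 * (\<beta> + 1) * r ^ (e - a - \<kappa>) \<le> real n / real h * (\<beta> + 1) * r ^ (e - a - \<kappa>)"
          using h r \<beta> by (intro mult_right_mono) (auto simp: field_simps)
        also have "\<dots> = 2 * real (Suc m) * real n / real h * (1 / (2 * real (Suc m))) * (\<beta> + 1) * r ^ (e - a - \<kappa>)"
          by (simp del: of_nat_Suc)
        finally show ?thesis unfolding Ks[OF \<kappa>(1)] .
      qed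
      ultimately have "(\<Sum>t=t0..<Suc \<tau>. gap_energy s a e t) + K * ?V (Suc \<tau>) powr s \<le> K * ?V t0 powr s"
        using \<rho> h less.prems \<tau>
        by (intro phase_payment[OF s ae large(1) \<tau>(1) _ _ drop _ K0]) auto
      then show ?thesis using \<tau> by (intro finish[of \<tau>]) auto
    qed
  qed
qed

text \<open>Induction on \<open>m\<close>. The fixed bound \<open>M\<close> keeps the base of the
  power the same at every level.\<close>

lemma energy_bound:
  fixes m M :: nat and s :: real
  assumes s: "0 < s" "s \<le> 1" and "m \<le> M" "a \<le> e" "e < n"
    and "\<And>t. t0 \<le> t \<Longrightarrow> t < t1 \<Longrightarrow> isolated a e t \<and> e - a < m + card (C t \<inter> {a..<e})"
  shows "(\<Sum>t=t0..<t1. gap_energy s a e t)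
         \<le> (6 * real M * real n / s) ^ m * (1/\<rho>) ^ (e - a) * width a e t0 powr s"
  using assms(3-)
proof (induction m arbitrary: a e t0 t1)
  case 0
  \<comment> \<open>Without any block there would be more crossed gaps than gaps, so the time range
    is empty.\<close>
  have "card (C t0 \<inter> {a..<e}) \<le> card {a..<e}" by (intro card_mono) auto
  then have "t1 \<le> t0" using 0(4)[of t0] by fastforce
  then show ?case using \<rho> by simp
next
  case (Suc m)
  define Q where "Q = 6 * real M * real n / s"
  show ?case
  proof (cases "a = e")
    case True
    then show ?thesis using \<rho> s by (simp add: gap_energy_def)
  next
    case False
    then have ae: "a < e" "e < n" using Suc.prems by auto
    have n2: "2 \<le> n" using ae by auto
    have mn: "2 * 1 \<le> real (Suc m) * real n / s * 1"
    proof -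
      have "1 * 2 \<le> real (Suc m) * real n" using n2 by (intro mult_mono) auto
      then show ?thesis using s by (simp add: field_simps del: of_nat_Suc)
    qed
    have Qm: "6 * (real (Suc m) * real n / s) \<le> Q"
      using Suc.prems(1) s unfolding Q_def by (simp add: divide_right_mono mult_right_mono)
    then have Q1: "1 \<le> Q" using mn by linarith
    have "(\<Sum>t=t0..<t1. gap_energy s a e t)
        \<le> 2 * real (Suc m) * real n / s * (Q ^ m + 1) * (1/\<rho>) ^ (e - a) * spread \<rho> a e (X t0) powr s
          + 2 * (Q ^ m + 1) * (1/\<rho>) ^ (e - a) * width a e t0 powr s"
    proof (intro energy_bound_step[OF s _ _ ae Suc.prems(4)])
      fix a e t0 t1
      assume "a \<le> e" "e < n"
        "\<And>t. t0 \<le> t \<Longrightarrow> t < t1 \<Longrightarrow> isolated a e t \<and> e - a < m + card (C t \<inter> {a..<e})"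
      then show "(\<Sum>t=t0..<t1. gap_energy s a e t) \<le> Q ^ m * (1/\<rho>) ^ (e - a) * width a e t0 powr s"
        unfolding Q_def using Suc.prems(1) by (intro Suc.IH) auto
    qed (use Q1 in auto)
    also have "\<dots> \<le> 2 * real (Suc m) * real n / s * (Q ^ m + 1) * (1/\<rho>) ^ (e - a) * width a e t0 powr s
          + 2 * (Q ^ m + 1) * (1/\<rho>) ^ (e - a) * width a e t0 powr s"
      using spread_le[OF dyn \<rho>, of e a t0] spread_nonneg[OF dyn \<rho>, of e a t0] ae s Q1 \<rho>
      by (intro add_right_mono mult_left_mono powr_mono2) (auto simp: width_def)
    also have "\<dots> = (2 * (real (Suc m) * real n / s) + 2) * (Q ^ m + 1) * ((1/\<rho>) ^ (e - a) * width a e t0 powr s)"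
      by (simp add: algebra_simps)
    also have "\<dots> \<le> Q ^ Suc m * ((1/\<rho>) ^ (e - a) * width a e t0 powr s)"
    proof (intro mult_right_mono)
      \<comment> \<open>Origin of the constant 6: with \<open>z = real (Suc m) * real n / s\<close>,
        \<open>z \<ge> 2\<close> gives \<open>2 * z + 2 \<le> 3 * z \<le> Q / 2\<close>, and
        \<open>Q ^ m + 1 \<le> 2 * Q ^ m\<close>.\<close>
      have "(2 * (real (Suc m) * real n / s) + 2) * (Q ^ m + 1) \<le> (Q / 2) * (2 * Q ^ m)"
        using Qm mn Q1 one_le_power[OF Q1, of m] by (intro mult_mono) auto
      then show "(2 * (real (Suc m) * real n / s) + 2) * (Q ^ m + 1) \<le> Q ^ Suc m" by simp
    qed (use \<rho> in auto)
    finally show ?thesis by (simp add: Q_def mult.assoc)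
  qed
qed

end

section \<open>Sorting the agents\<close>

definition sorts :: "nat \<Rightarrow> (nat \<Rightarrow> nat) \<Rightarrow> (nat \<Rightarrow> real) \<Rightarrow> bool" where
  "sorts n \<sigma> x \<longleftrightarrow> bij_betw \<sigma> {..<n} {..<n} \<and> (\<forall>i j. i \<le> j \<longrightarrow> j < n \<longrightarrow> x (\<sigma> i) \<le> x (\<sigma> j))"

lemma sorts_sort_key: "sorts n (nth (sort_key x [0..<n])) x"
proof -
  have "bij_betw (nth (sort_key x [0..<n])) {..<n} {..<n}"
    by (intro bij_betw_nth) auto
  moreover have "x (sort_key x [0..<n] ! i) \<le> x (sort_key x [0..<n] ! j)" if "i \<le> j" "j < n" for i j
    using sorted_nth_mono[OF sorted_sort_key[of x "[0..<n]"] that(1)] that by simp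
  ultimately show ?thesis unfolding sorts_def by blast
qed

lemma sorts_less: "sorts n \<sigma> x \<Longrightarrow> i < n \<Longrightarrow> \<sigma> i < n"
  unfolding sorts_def using bij_betwE by blast

lemma sorts_mono: "sorts n \<sigma> x \<Longrightarrow> i \<le> j \<Longrightarrow> j < n \<Longrightarrow> x (\<sigma> i) \<le> x (\<sigma> j)"
  unfolding sorts_def by blast

lemma sorts_position:
  assumes "sorts n \<sigma> x" "k < n"
  obtains q where "q < n" "\<sigma> q = k"
proof -
  have "k \<in> \<sigma> ` {..<n}" using assms unfolding sorts_def bij_betw_def by simp
  then show thesis using that by blast
qed

text \<open>No agent lies strictly between two neighbouring ranks.\<close>

lemma sorts_less_Suc_imp_le:
  assumes "sorts n \<sigma> x" "k < n" "Suc q < n" "x k < x (\<sigma> (Suc q))"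
  shows "x k \<le> x (\<sigma> q)"
proof -
  obtain l where "l < n" "\<sigma> l = k" using sorts_position[OF assms(1,2)] by blast
  moreover from this have "l \<le> q"
    using assms(4) sorts_mono[OF assms(1), of "Suc q" l] by (metis not_less not_less_eq_eq)
  ultimately show ?thesis using sorts_mono[OF assms(1), of l q] assms by auto
qed

text \<open>With its converse \<open>sorts_ge_of_card\<close>, this describes sorted positions by
  counting agents above a level. Positions before and after a step can then be compared without
  following how the order of the agents changes.\<close>

lemma sorts_card_ge:
  assumes "sorts n \<sigma> x" "i \<le> n" "\<And>k. i \<le> k \<Longrightarrow> k < n \<Longrightarrow> c \<le> x (\<sigma> k)"
  shows "n - i \<le> card {j. j < n \<and> c \<le> x j}"
proof -
  have "inj_on \<sigma> {i..<n}"
    using assms(1) unfolding sorts_def bij_betw_def by (auto intro: inj_on_subset)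
  then have "n - i = card (\<sigma> ` {i..<n})" by (simp add: card_image)
  also have "\<dots> \<le> card {j. j < n \<and> c \<le> x j}"
    using assms sorts_less[OF assms(1)] by (intro card_mono) auto
  finally show ?thesis .
qed

lemma sorts_ge_of_card:
  assumes "sorts n \<sigma> x" "i < n" "n - i \<le> card {j. j < n \<and> c \<le> x j}"
  shows "c \<le> x (\<sigma> i)"
proof (rule ccontr)
  assume "\<not> c \<le> x (\<sigma> i)"
  then have lt: "\<not> c \<le> x (\<sigma> k)" if "k \<le> i" for k
    using sorts_mono[OF assms(1) that assms(2)] by linarith
  have "inj_on \<sigma> {..i}"
    using assms(1,2) unfolding sorts_def bij_betw_def by (auto intro: inj_on_subset)
  then have "Suc i = card (\<sigma> ` {..i})" by (simp add: card_image)
  also have "\<dots> \<le> card ({..<n} - {j. j < n \<and> c \<le> x j})"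
    using lt assms(2) sorts_less[OF assms(1)] by (intro card_mono) auto
  also have "\<dots> = n - card {j. j < n \<and> c \<le> x j}"
    by (subst card_Diff_subset) auto
  finally show False using assms by linarith
qed

text \<open>Reflection of the line, by which upper bounds follow from lower ones.\<close>

lemma sorts_reverse:
  assumes "sorts n \<sigma> x"
  shows "sorts n (\<lambda>i. \<sigma> (n - 1 - i)) (\<lambda>i. - x i)"
proof -
  have "bij_betw (\<lambda>i. n - 1 - i) {..<n} {..<n}"
    by (rule bij_betwI[where g = "\<lambda>i. n - 1 - i"]) auto
  then have "bij_betw (\<sigma> \<circ> (\<lambda>i. n - 1 - i)) {..<n} {..<n}"
    using assms unfolding sorts_def by (blast intro: bij_betw_trans)
  then show ?thesis
    using sorts_mono[OF assms] by (auto simp: sorts_def comp_def)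
qed

text \<open>Ties count as crossed: agents at the same position must not split a block.\<close>

definition crossed :: "nat \<Rightarrow> (nat \<Rightarrow> nat \<Rightarrow> real) \<Rightarrow> (nat \<Rightarrow> real) \<Rightarrow> (nat \<Rightarrow> nat) \<Rightarrow> nat set" where
  "crossed n A x \<sigma> = {p. Suc p < n \<and> (x (\<sigma> p) = x (\<sigma> (Suc p)) \<or>
     (\<exists>i<n. \<exists>j<n. 0 < A i j \<and> x i \<le> x (\<sigma> p) \<and> x (\<sigma> (Suc p)) \<le> x j))}"

section \<open>One averaging step on sorted agents\<close>

locale averaging_matrix =
  fixes n :: nat and \<rho> :: real and A :: "nat \<Rightarrow> nat \<Rightarrow> real"
  assumes nonneg: "\<And>i j. i < n \<Longrightarrow> j < n \<Longrightarrow> 0 \<le> A i j"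
    and sym: "\<And>i j. i < n \<Longrightarrow> j < n \<Longrightarrow> 0 < A i j \<Longrightarrow> 0 < A j i"
    and threshold: "\<And>i j. i < n \<Longrightarrow> j < n \<Longrightarrow> 0 < A i j \<Longrightarrow> \<rho> \<le> A i j"
    and diag: "\<And>i. i < n \<Longrightarrow> 0 < A i i"
    and stochastic: "\<And>i. i < n \<Longrightarrow> (\<Sum>j<n. A i j) = 1"
begin

lemma finite_crossed: "finite (crossed n A x \<sigma>)"
  by (rule finite_subset[of _ "{..<n}"]) (auto simp: crossed_def)

text \<open>An edge leading below the bottom \<open>u\<close> of a block would cover the gap just
  below \<open>u\<close>.\<close>

lemma edge_stays_above:
  assumes "sorts n \<sigma> x" "left_closed (crossed n A x \<sigma>) u" "u < n"
    and "j < n" "k < n" "0 < A j k" "x (\<sigma> u) \<le> x j"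
  shows "x (\<sigma> u) \<le> x k"
proof (cases u)
  case 0
  obtain q where "q < n" "\<sigma> q = k" using sorts_position[OF assms(1,5)] .
  then show ?thesis using sorts_mono[OF assms(1), of 0 q] 0 by auto
next
  case (Suc p)
  show ?thesis
  proof (rule ccontr)
    assume "\<not> x (\<sigma> u) \<le> x k"
    then have "x k \<le> x (\<sigma> p)"
      using sorts_less_Suc_imp_le[OF assms(1,5), of p] Suc assms(3) by auto
    then have "p \<in> crossed n A x \<sigma>"
      using Suc assms sym unfolding crossed_def by auto
    then show False using assms(2) Suc by (auto simp: left_closed_def)
  qed
qed

text \<open>Relative to \<open>x (\<sigma> u)\<close> every term of the average is nonnegative by
  \<open>edge_stays_above\<close>, and the neighbour \<open>k\<close> alone contributes the claimed
  amount.\<close>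

lemma average_ge:
  assumes "sorts n \<sigma> x" "left_closed (crossed n A x \<sigma>) u" "u < n" "0 \<le> \<rho>"
    and "j < n" "k < n" "0 < A j k" "x (\<sigma> u) \<le> x j" "x (\<sigma> u) \<le> w" "w \<le> x k"
  shows "x (\<sigma> u) + \<rho> * (w - x (\<sigma> u)) \<le> (\<Sum>l<n. A j l * x l)"
proof -
  have "\<rho> * (w - x (\<sigma> u)) \<le> A j k * (x k - x (\<sigma> u))"
    using assms threshold[of j k] by (intro mult_mono) auto
  also have "\<dots> \<le> (\<Sum>l<n. A j l * (x l - x (\<sigma> u)))"
  proof (intro member_le_sum)
    fix l assume "l \<in> {..<n} - {k}"
    then show "0 \<le> A j l * (x l - x (\<sigma> u))"
      using edge_stays_above[OF assms(1-3), of j l] nonneg[of j l] assms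
      by (cases "A j l = 0") auto
  qed (use assms in auto)
  also have "\<dots> = (\<Sum>l<n. A j l * x l) - x (\<sigma> u)"
    using stochastic[OF assms(5)] by (simp add: right_diff_distrib sum_subtractf flip: sum_distrib_right)
  finally show ?thesis by simp
qed

text \<open>Every agent at or above the gap \<open>i\<close> keeps a \<open>\<rho>\<close>-fraction of its distance to the left end of
  the block, and if the gap is crossed then so does at least one agent from below it.\<close>

lemma sorted_lower_bound:
  assumes \<sigma>: "sorts n \<sigma> x" and \<tau>: "sorts n \<tau> (\<lambda>i. \<Sum>j<n. A i j * x j)" and \<rho>: "0 \<le> \<rho>"
    and u: "left_closed (crossed n A x \<sigma>) u" "u \<le> i" "i < n"
  shows "x (\<sigma> u) + \<rho> * (x (\<sigma> (if i \<in> crossed n A x \<sigma> then Suc i else i)) - x (\<sigma> u))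
         \<le> (\<Sum>j<n. A (\<tau> i) j * x j)"
proof -
  let ?C = "crossed n A x \<sigma>"
  define w where "w = x (\<sigma> (if i \<in> ?C then Suc i else i))"
  have iw: "i \<in> ?C \<Longrightarrow> Suc i < n" by (simp add: crossed_def)
  have uw: "x (\<sigma> u) \<le> w"
    using sorts_mono[OF \<sigma>, of u] u iw by (auto simp: w_def)
  have un: "u < n" using u by simp
  let ?good = "{j. j < n \<and> x (\<sigma> u) + \<rho> * (w - x (\<sigma> u)) \<le> (\<Sum>l<n. A j l * x l)}"
  have above: "{j. j < n \<and> w \<le> x j} \<subseteq> ?good"
    using average_ge[OF \<sigma> u(1) un \<rho>] diag uw by fastforce
  have "n - i \<le> card ?good"
  proof (cases "i \<in> ?C \<and> x (\<sigma> i) < x (\<sigma> (Suc i))")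
    case True
    then obtain k j where kj: "k < n" "j < n" "0 < A k j" "x k \<le> x (\<sigma> i)" "x (\<sigma> (Suc i)) \<le> x j"
      by (auto simp: crossed_def)
    have w: "w = x (\<sigma> (Suc i))" using True by (simp add: w_def)
    have "x (\<sigma> u) \<le> x k"
      using edge_stays_above[OF \<sigma> u(1) un, of j k] kj sym uw w by auto
    then have "k \<in> ?good"
      using average_ge[OF \<sigma> u(1) un \<rho>, of k j w] kj w uw by auto
    moreover have "k \<notin> {j. j < n \<and> w \<le> x j}" using kj True w by auto
    \<comment> \<open>Only \<open>n - Suc i\<close> agents are certain to be at or above
      \<open>w\<close>; the lower endpoint \<open>k\<close> of the covering edge supplies the
      missing one.\<close>
    ultimately have "Suc (card {j. j < n \<and> w \<le> x j}) \<le> card ?good"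
      using above card_mono[of ?good "insert k {j. j < n \<and> w \<le> x j}"] by auto
    moreover have "n - Suc i \<le> card {j. j < n \<and> w \<le> x j}"
      using sorts_mono[OF \<sigma>] iw True w by (intro sorts_card_ge[OF \<sigma>]) auto
    ultimately show ?thesis by linarith
  next
    case False
    \<comment> \<open>The gap is uncrossed or a tie; in either case rank \<open>i\<close> itself
      already reaches \<open>w\<close>.\<close>
    then have "w \<le> x (\<sigma> i)" by (auto simp: w_def)
    then have "w \<le> x (\<sigma> k)" if "i \<le> k" "k < n" for k
      using sorts_mono[OF \<sigma> that] by linarith
    then have "n - i \<le> card {j. j < n \<and> w \<le> x j}"
      using u by (intro sorts_card_ge[OF \<sigma>]) auto
    also have "\<dots> \<le> card ?good" using above by (intro card_mono) auto
    finally show ?thesis .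
  qed
  then show ?thesis
    using sorts_ge_of_card[OF \<tau> u(3)] by (simp add: w_def)
qed

text \<open>Rank \<open>i\<close> goes to \<open>n - 1 - i\<close>, so the gap above
  \<open>p\<close> goes to the gap above \<open>n - 2 - p\<close>. The endpoints of a covering edge
  trade places, whence the appeal to \<open>sym\<close>.\<close>

lemma crossed_reverse:
  "crossed n A (\<lambda>i. - x i) (\<lambda>i. \<sigma> (n - 1 - i)) = {p. Suc p < n \<and> n - 2 - p \<in> crossed n A x \<sigma>}"
proof -
  have "p \<in> crossed n A (\<lambda>i. - x i) (\<lambda>i. \<sigma> (n - 1 - i)) \<longleftrightarrow> n - 2 - p \<in> crossed n A x \<sigma>"
    if p: "Suc p < n" for p
  proof -
    define q where "q = n - 2 - p"
    have q: "n - 1 - Suc p = q" "n - 1 - p = Suc q" "Suc q < n" using p by (auto simp: q_def)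
    have "(\<exists>i<n. \<exists>j<n. 0 < A i j \<and> - x i \<le> - x (\<sigma> (Suc q)) \<and> - x (\<sigma> q) \<le> - x j) \<longleftrightarrow>
        (\<exists>i<n. \<exists>j<n. 0 < A i j \<and> x i \<le> x (\<sigma> q) \<and> x (\<sigma> (Suc q)) \<le> x j)"
      using sym by (simp only: neg_le_iff_le) blast
    then show ?thesis
      unfolding crossed_def mem_Collect_eq q q_def[symmetric] using p q by auto
  qed
  moreover have "Suc p < n" if "p \<in> crossed n A (\<lambda>i. - x i) (\<lambda>i. \<sigma> (n - 1 - i))" for p
    using that unfolding crossed_def by blast
  ultimately show ?thesis by blast
qed

text \<open>The upper bound at \<open>i\<close> is \<open>sorted_lower_bound\<close> for the
  reflected system, in which the gap below \<open>i\<close> becomes the gap above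
  \<open>n - 1 - i\<close>.\<close>

lemma sorted_step:
  assumes \<sigma>: "sorts n \<sigma> x" and \<tau>: "sorts n \<tau> (\<lambda>i. \<Sum>j<n. A i j * x j)" and \<rho>: "0 \<le> \<rho>"
  shows "contraction_step n \<rho> (crossed n A x \<sigma>) (\<lambda>i. x (\<sigma> i)) (\<lambda>i. \<Sum>j<n. A (\<tau> i) j * x j)"
  unfolding contraction_step_def
proof (intro conjI allI impI ballI)
  let ?C = "crossed n A x \<sigma>"
  fix i v assume iv: "i \<le> v" "v < n" "v \<notin> ?C"
  let ?\<sigma> = "\<lambda>i. \<sigma> (n - 1 - i)" and ?\<tau> = "\<lambda>i. \<tau> (n - 1 - i)" and ?x = "\<lambda>i. - x i"
  let ?i = "n - 1 - i" and ?u = "n - 1 - v"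
  let ?C' = "crossed n A ?x ?\<sigma>"
  have "(\<lambda>i. \<Sum>j<n. A i j * ?x j) = (\<lambda>i. - (\<Sum>j<n. A i j * x j))"
    by (simp add: sum_negf)
  then have \<tau>': "sorts n ?\<tau> (\<lambda>i. \<Sum>j<n. A i j * ?x j)"
    using sorts_reverse[OF \<tau>] by simp
  have uc: "left_closed ?C' ?u"
  proof (unfold left_closed_def, intro allI impI)
    fix p assume "Suc p = ?u"
    then have "n - 2 - p = v" using iv by auto
    then show "p \<notin> ?C'" using iv unfolding crossed_reverse by simp
  qed
  have iC: "?i \<in> ?C' \<longleftrightarrow> \<not> left_closed ?C i"
  proof (cases i)
    case 0
    then show ?thesis using iv unfolding crossed_def left_closed_def by auto
  next
    case (Suc k)
    then have "n - 2 - ?i = k" "Suc ?i < n" using iv by auto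
    then show ?thesis using Suc unfolding crossed_reverse left_closed_def by auto
  qed
  have idx: "n - 1 - Suc ?i = i - 1" "n - 1 - ?i = i" "n - 1 - ?u = v" using iv by auto
  have "?u \<le> ?i" "?i < n" using iv by auto
  note lower = sorted_lower_bound[OF sorts_reverse[OF \<sigma>] \<tau>' \<rho> uc this]
  show "(\<Sum>j<n. A (\<tau> i) j * x j)
      \<le> x (\<sigma> v) - \<rho> * (x (\<sigma> v) - x (\<sigma> (if left_closed ?C i then i else i - 1)))"
  proof (cases "left_closed ?C i")
    case True
    with iC have "?i \<notin> ?C'" by blast
    then show ?thesis
      using lower True unfolding if_not_P[OF \<open>?i \<notin> ?C'\<close>] idx by (simp add: sum_negf algebra_simps)
  next
    case False
    with iC have "?i \<in> ?C'" by blast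
    then show ?thesis
      using lower False unfolding if_P[OF \<open>?i \<in> ?C'\<close>] idx by (simp add: sum_negf algebra_simps)
  qed
next
  show "x (\<sigma> i) \<le> x (\<sigma> j)" if "i \<le> j" "j < n" for i j
    using sorts_mono[OF \<sigma> that] .
  show "Suc p < n" if "p \<in> crossed n A x \<sigma>" for p
    using that by (simp add: crossed_def)
  show "x (\<sigma> u) + \<rho> * (x (\<sigma> (if i \<in> crossed n A x \<sigma> then Suc i else i)) - x (\<sigma> u))
      \<le> (\<Sum>j<n. A (\<tau> i) j * x j)" if "u \<le> i" "i < n" "left_closed (crossed n A x \<sigma>) u" for u i
    using sorted_lower_bound[OF \<sigma> \<tau> \<rho> that(3,1,2)] .
qed

text \<open>Bottoms of different blocks lie in different components, because no path leads below the
  bottom of a block.\<close>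

lemma components_plus_crossed:
  assumes \<sigma>: "sorts n \<sigma> x"
  shows "n \<le> card ({0..<n} // {(i, j). i < n \<and> j < n \<and> 0 < A i j}\<^sup>*) + card (crossed n A x \<sigma>)"
proof -
  let ?C = "crossed n A x \<sigma>" and ?E = "{(i, j). i < n \<and> j < n \<and> 0 < A i j}"
  let ?U = "{u. u < n \<and> left_closed ?C u}"
  have stays: "x (\<sigma> u) \<le> x k" if "(j, k) \<in> ?E\<^sup>*" "u \<in> ?U" "x (\<sigma> u) \<le> x j" for j k u
    using that(1)
  proof induction
    case (step k l)
    then show ?case using edge_stays_above[OF \<sigma>, of u k l] that by auto
  qed (use that in simp)
  have sep: "?E\<^sup>* `` {\<sigma> u} \<noteq> ?E\<^sup>* `` {\<sigma> v}" if uv: "u < v" "u \<in> ?U" "v \<in> ?U" for u v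
  proof
    assume "?E\<^sup>* `` {\<sigma> u} = ?E\<^sup>* `` {\<sigma> v}"
    then have "(\<sigma> v, \<sigma> u) \<in> ?E\<^sup>*" by auto
    then have 1: "x (\<sigma> v) \<le> x (\<sigma> u)" using stays uv by blast
    \<comment> \<open>All ranks from \<open>u\<close> to \<open>v\<close> are now tied, so the gap
      just below \<open>v\<close> counts as crossed, against \<open>v\<close> being a
      bottom.\<close>
    obtain p where p: "v = Suc p" "u \<le> p" using uv(1) by (cases v) auto
    then have "x (\<sigma> p) = x (\<sigma> v)"
      using 1 sorts_mono[OF \<sigma>, of u p] sorts_mono[OF \<sigma>, of p v] uv by auto
    then have "p \<in> ?C" using p uv by (simp add: crossed_def)
    then show False using uv p by (simp add: left_closed_def)
  qed
  have "inj_on (\<lambda>u. ?E\<^sup>* `` {\<sigma> u}) ?U"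
  proof (rule inj_onI)
    fix u v assume "u \<in> ?U" "v \<in> ?U" "?E\<^sup>* `` {\<sigma> u} = ?E\<^sup>* `` {\<sigma> v}"
    then show "u = v"
      using sep[of u v] sep[of v u] by (cases u v rule: linorder_cases) auto
  qed
  then have "card ?U = card ((\<lambda>u. ?E\<^sup>* `` {\<sigma> u}) ` ?U)" by (simp add: card_image)
  also have "\<dots> \<le> card ({0..<n} // ?E\<^sup>*)"
  proof (intro card_mono image_subsetI)
    show "?E\<^sup>* `` {\<sigma> u} \<in> {0..<n} // ?E\<^sup>*" if "u \<in> ?U" for u
      using sorts_less[OF \<sigma>, of u] that by (intro quotientI) auto
  qed (auto simp: quotient_def)
  finally have "card ?U \<le> card ({0..<n} // ?E\<^sup>*)" .
  \<comment> \<open>Every rank is a bottom or sits right above a crossed gap.\<close>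
  moreover have "{..<n} = ?U \<union> Suc ` ?C"
    by (auto simp: left_closed_def crossed_def)
  then have "n \<le> card ?U + card (Suc ` ?C)"
    by (metis card_Un_le card_lessThan)
  moreover have "card (Suc ` ?C) = card ?C" by (simp add: card_image)
  ultimately show ?thesis by linarith
qed

text \<open>A block is a compact interval between two agents, so its length is a sum of gaps, and
  those of positive length are crossed. Subadditivity of the power and disjointness of the blocks do
  the rest.\<close>

lemma component_energy_le:
  fixes s :: real
  assumes s: "0 < s" "s \<le> 1" and \<sigma>: "sorts n \<sigma> x"
  defines "U \<equiv> \<Union>(i, j) \<in> {(i, j). i < n \<and> j < n \<and> i \<noteq> j \<and> 0 < A i j}. {min (x i) (x j)..max (x i) (x j)}"
  shows "(\<Sum>c\<in>components U. (Sup c - Inf c) powr s)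
         \<le> (\<Sum>p\<in>crossed n A x \<sigma>. gap (\<lambda>i. x (\<sigma> i)) p powr s)"
proof (cases "finite (components U)")
  \<comment> \<open>A sum over an infinite set is 0 by convention, so this case is harmless.\<close>
  case False
  then show ?thesis by (simp add: sum_nonneg)
next
  case True
  let ?C = "crossed n A x \<sigma>" and ?X = "\<lambda>i. x (\<sigma> i)"
  define G where "G c = {p \<in> ?C. ?X p < ?X (Suc p) \<and> ?X p \<in> c \<and> ?X (Suc p) \<in> c}" for c
  have finC: "finite ?C" by (rule finite_crossed)
  have finE: "finite {(i, j). i < n \<and> j < n \<and> i \<noteq> j \<and> 0 < A i j}"
    by (rule finite_subset[of _ "{..<n} \<times> {..<n}"]) auto
  have U: "compact U"
    unfolding U_def using finE by (intro compact_UN) auto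
  have comp: "(Sup c - Inf c) powr s \<le> (\<Sum>p\<in>G c. gap ?X p powr s)" if c: "c \<in> components U" for c
  proof -
    have "compact c"
      using U c by (simp add: compact_components)
    moreover have "connected c" using c by (rule in_components_connected)
    ultimately obtain \<alpha> \<beta> where cab: "c = {\<alpha>..\<beta>}"
      using connected_compact_interval_1[of c] by blast
    have ab: "\<alpha> \<le> \<beta>" using in_components_nonempty[OF c] cab by auto
    \<comment> \<open>By maximality the whole covering edge lies in the block \<open>c\<close>. At
      the two extreme points this forces an agent to be there.\<close>
    have edge: "\<exists>i<n. \<exists>j<n. 0 < A i j \<and> x i \<le> z \<and> z \<le> x j \<and> x i \<in> c \<and> x j \<in> c" if "z \<in> c" for z
    proof -
      have "z \<in> U" using in_components_subset[OF c] that by auto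
      then obtain i j where ij: "i < n" "j < n" "i \<noteq> j" "0 < A i j" "z \<in> {min (x i) (x j)..max (x i) (x j)}"
        unfolding U_def by auto
      have "{min (x i) (x j)..max (x i) (x j)} \<subseteq> U" using ij unfolding U_def by blast
      then have sub: "{min (x i) (x j)..max (x i) (x j)} \<subseteq> c"
        using ij that c by (intro components_maximal[OF c]) auto
      then have "x i \<in> c" "x j \<in> c" by auto
      then show ?thesis
        using ij sym[of i j] by (cases "x i \<le> x j") (auto simp: min_def max_def)
    qed
    obtain i where i: "i < n" "x i = \<alpha>"
      using edge[of \<alpha>] ab unfolding cab by force
    obtain j where j: "j < n" "x j = \<beta>"
      using edge[of \<beta>] ab unfolding cab by force
    obtain q where q: "q < n" "?X q = \<alpha>" using sorts_position[OF \<sigma> i(1)] i(2) by metis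
    obtain r where r: "r < n" "?X r = \<beta>" using sorts_position[OF \<sigma> j(1)] j(2) by metis
    show ?thesis
    proof (cases "\<alpha> = \<beta>")
      case True
      then show ?thesis using s unfolding cab by (simp add: sum_nonneg)
    next
      case False
      then have lt: "\<alpha> < \<beta>" using ab by simp
      then have qr: "q < r"
        using q r sorts_mono[OF \<sigma>, of r q] by (metis leD leI)
      have nn: "0 \<le> gap ?X p" if "p \<in> {q..<r}" for p
        using sorts_mono[OF \<sigma>, of p "Suc p"] that r by (auto simp: gap_def)
      have "Sup c - Inf c = (\<Sum>p\<in>{q..<r}. gap ?X p)"
        using sum_Suc_diff'[of q r ?X] qr q r ab by (simp add: cab gap_def)
      also have "\<dots> powr s \<le> (\<Sum>p\<in>{q..<r}. gap ?X p powr s)"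
        using s nn by (intro powr_sum_le) auto
      also have "\<dots> = (\<Sum>p\<in>{p \<in> {q..<r}. ?X p < ?X (Suc p)}. gap ?X p powr s)"
      proof (intro sum.mono_neutral_right ballI)
        fix p assume "p \<in> {q..<r} - {p \<in> {q..<r}. ?X p < ?X (Suc p)}"
        then have "gap ?X p = 0" using nn[of p] by (auto simp: gap_def)
        then show "gap ?X p powr s = 0" by simp
      qed auto
      also have "\<dots> \<le> (\<Sum>p\<in>G c. gap ?X p powr s)"
      proof (intro sum_mono2 subsetI)
        fix p assume "p \<in> {p \<in> {q..<r}. ?X p < ?X (Suc p)}"
        then have p: "q \<le> p" "p < r" "?X p < ?X (Suc p)" by auto
        then have pc: "?X p \<in> c" "?X (Suc p) \<in> c"
          using sorts_mono[OF \<sigma>, of q p] sorts_mono[OF \<sigma>, of "Suc p" r] q r unfolding cab by auto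
        \<comment> \<open>No agent sits strictly inside the gap, so an edge covering its midpoint
          spans all of it.\<close>
        define z where "z = (?X p + ?X (Suc p)) / 2"
        have z: "?X p < z" "z < ?X (Suc p)" using p by (auto simp: z_def field_simps)
        then obtain i j where ij: "i < n" "j < n" "0 < A i j" "x i \<le> z" "z \<le> x j"
          using edge[of z] pc unfolding cab by fastforce
        have "x i \<le> ?X p"
          using sorts_less_Suc_imp_le[OF \<sigma> ij(1), of p] p r z ij by auto
        moreover have "?X (Suc p) \<le> x j"
        proof -
          obtain l where l: "l < n" "\<sigma> l = j" using sorts_position[OF \<sigma> ij(2)] by metis
          then have "Suc p \<le> l"
            using sorts_mono[OF \<sigma>, of l p] p r z ij by (cases "l \<le> p") auto
          then show ?thesis using sorts_mono[OF \<sigma>, of "Suc p" l] l by auto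
        qed
        ultimately have "p \<in> ?C" using ij p r unfolding crossed_def by auto
        then show "p \<in> G c" using p pc by (simp add: G_def)
      qed (auto simp: G_def finC)
      finally show ?thesis .
    qed
  qed
  have "(\<Sum>c\<in>components U. (Sup c - Inf c) powr s) \<le> (\<Sum>c\<in>components U. \<Sum>p\<in>G c. gap ?X p powr s)"
    by (intro sum_mono comp)
  also have "\<dots> = (\<Sum>p\<in>(\<Union>c\<in>components U. G c). gap ?X p powr s)"
  proof (intro sum.UNION_disjoint[symmetric] ballI impI)
    fix c d assume "c \<in> components U" "d \<in> components U" "c \<noteq> d"
    then have "c \<inter> d = {}"
      using pairwise_disjoint_components[of U] by (auto simp: pairwise_def)
    then show "G c \<inter> G d = {}" by (auto simp: G_def)
  qed (auto simp: True G_def finC)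
  also have "\<dots> \<le> (\<Sum>p\<in>?C. gap ?X p powr s)"
    using finC by (intro sum_mono2) (auto simp: G_def)
  finally show ?thesis .
qed

end

section \<open>Averaging systems\<close>

abbreviation ranking :: "nat \<Rightarrow> (nat \<Rightarrow> nat \<Rightarrow> nat \<Rightarrow> real) \<Rightarrow> (nat \<Rightarrow> real) \<Rightarrow> nat \<Rightarrow> nat \<Rightarrow> nat" where
  "ranking n P x0 t \<equiv> nth (sort_key (traj n P x0 t) [0..<n])"

abbreviation sorted_traj :: "nat \<Rightarrow> (nat \<Rightarrow> nat \<Rightarrow> nat \<Rightarrow> real) \<Rightarrow> (nat \<Rightarrow> real) \<Rightarrow> nat \<Rightarrow> nat \<Rightarrow> real" where
  "sorted_traj n P x0 t \<equiv> \<lambda>i. traj n P x0 t (ranking n P x0 t i)"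

abbreviation crossed_traj :: "nat \<Rightarrow> (nat \<Rightarrow> nat \<Rightarrow> nat \<Rightarrow> real) \<Rightarrow> (nat \<Rightarrow> real) \<Rightarrow> nat \<Rightarrow> nat set" where
  "crossed_traj n P x0 t \<equiv> crossed n (P t) (traj n P x0 t) (ranking n P x0 t)"

lemma averaging_matrix_system: "avg_system n \<rho> P \<Longrightarrow> averaging_matrix n \<rho> (P t)"
  unfolding avg_system_def by unfold_locales blast+

lemma contraction_system_sorted_traj:
  assumes "avg_system n \<rho> P" "0 < \<rho>" "\<rho> \<le> 1/2"
  shows "contraction_system n \<rho> (sorted_traj n P x0) (crossed_traj n P x0)"
proof
  fix t
  have "sorts n (ranking n P x0 (Suc t)) (\<lambda>i. \<Sum>j<n. P t i j * traj n P x0 t j)"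
    using sorts_sort_key[of n "traj n P x0 (Suc t)"] by simp
  from averaging_matrix.sorted_step[OF averaging_matrix_system[OF assms(1)] sorts_sort_key this] assms(2)
  show "contraction_step n \<rho> (crossed_traj n P x0 t) (sorted_traj n P x0 t) (sorted_traj n P x0 (Suc t))"
    by simp
qed (use assms in auto)

lemma energy_le:
  assumes avg: "avg_system n \<rho> P" and s: "0 < s" "s \<le> 1"
    and bound: "\<And>T. (\<Sum>t<T. \<Sum>p\<in>crossed_traj n P x0 t. gap (sorted_traj n P x0 t) p powr s) \<le> B"
  shows "energy n P x0 s \<le> ennreal B"
  unfolding energy_def
proof (rule suminf_le_const)
  fix T
  have nonneg: "0 \<le> energy_t n P x0 s t" for t
    unfolding energy_t_def by (intro sum_nonneg) auto
  have "energy_t n P x0 s t \<le> (\<Sum>p\<in>crossed_traj n P x0 t. gap (sorted_traj n P x0 t) p powr s)" for t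
    using averaging_matrix.component_energy_le[OF averaging_matrix_system[OF avg] s sorts_sort_key]
    unfolding energy_t_def edge_union_def by blast
  then have "(\<Sum>t<T. energy_t n P x0 s t) \<le> B"
    by (intro order_trans[OF sum_mono bound])
  then show "(\<Sum>t<T. ennreal (energy_t n P x0 s t)) \<le> ennreal B"
    using nonneg by (simp add: sum_ennreal ennreal_leI)
qed simp

lemma initial_width_le:
  assumes "2 \<le> n" "\<forall>i<n. x0 i \<in> {0..1}"
  shows "sorted_traj n P x0 0 (n - 1) - sorted_traj n P x0 0 0 \<le> 1"
proof -
  have "ranking n P x0 0 (n - 1) < n" "ranking n P x0 0 0 < n"
    using sorts_less[OF sorts_sort_key] assms(1) by auto
  then show ?thesis using assms(2) by (smt (verit) atLeastAtMost_iff traj.simps(1))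
qed

lemma energy_one_le:
  assumes avg: "avg_system n \<rho> P" and \<rho>: "0 < \<rho>" "\<rho> \<le> 1/2" and n: "2 \<le> n"
    and x0: "\<forall>i<n. x0 i \<in> {0..1}"
  shows "energy n P x0 1 \<le> ennreal (3 * exp 1 * real n * (1/\<rho>) ^ (n div 2))"
proof (rule energy_le[OF avg])
  fix T
  interpret contraction_system n \<rho> "sorted_traj n P x0" "crossed_traj n P x0"
    using contraction_system_sorted_traj[OF avg \<rho>] .
  have "(\<Sum>t<T. \<Sum>p\<in>crossed_traj n P x0 t. gap (sorted_traj n P x0 t) p powr 1)
      = (\<Sum>t<T. \<Sum>p\<in>crossed_traj n P x0 t. gap (sorted_traj n P x0 t) p)"
    using gap_nonneg by (intro sum.cong refl) (simp add: crossed_def)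
  also have "\<dots> \<le> real (n div 2) * (1/\<rho>) ^ (n div 2) * width 0 (n - 1) 0"
    by (rule total_crossed_gaps[OF n])
  also have "\<dots> \<le> real (n div 2) * (1/\<rho>) ^ (n div 2) * 1"
    using initial_width_le[OF n x0] \<rho> unfolding width_def by (intro mult_left_mono) auto
  also have "\<dots> \<le> 3 * exp 1 * real n * (1/\<rho>) ^ (n div 2)"
  proof -
    have "1 * real (n div 2) \<le> (3 * exp 1) * real n"
      by (intro mult_mono) (use exp_ge_add_one_self[of "1::real"] in auto)
    then show ?thesis using \<rho> mult_right_mono by fastforce
  qed
  finally show "(\<Sum>t<T. \<Sum>p\<in>crossed_traj n P x0 t. gap (sorted_traj n P x0 t) p powr 1)
      \<le> 3 * exp 1 * real n * (1/\<rho>) ^ (n div 2)" .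
qed auto

lemma energy_s_le:
  assumes avg: "avg_system n \<rho> P" and \<rho>: "0 < \<rho>" "\<rho> \<le> 1/2" and n: "2 \<le> n"
    and x0: "\<forall>i<n. x0 i \<in> {0..1}" and m: "\<forall>t. num_components n P t \<le> m"
    and s: "0 < s" "s \<le> 1"
  shows "energy n P x0 s \<le> ennreal ((6 * real m * real n / s) ^ m * (1/\<rho>) ^ (n - 1))"
proof (rule energy_le[OF avg s])
  fix T
  interpret contraction_system n \<rho> "sorted_traj n P x0" "crossed_traj n P x0"
    using contraction_system_sorted_traj[OF avg \<rho>] .
  have whole: "crossed_traj n P x0 t \<inter> {0..<n - 1} = crossed_traj n P x0 t" for t
    by (auto simp: crossed_def)
  have few: "isolated 0 (n - 1) t \<and> n - 1 - 0 < m + card (crossed_traj n P x0 t \<inter> {0..<n - 1})" for t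
  proof -
    \<comment> \<open>As \<open>n > n - 1\<close>, this yields the strict inequality by which
      \<open>energy_bound\<close> counts blocks.\<close>
    have "n \<le> num_components n P t + card (crossed_traj n P x0 t)"
      using averaging_matrix.components_plus_crossed[OF averaging_matrix_system[OF avg] sorts_sort_key]
      unfolding num_components_def graph_edges_def by auto
    moreover have "num_components n P t \<le> m" using m by blast
    ultimately show ?thesis unfolding whole using isolated_whole[of t] n by linarith
  qed
  have "(\<Sum>t<T. \<Sum>p\<in>crossed_traj n P x0 t. gap (sorted_traj n P x0 t) p powr s)
      = (\<Sum>t=0..<T. gap_energy s 0 (n - 1) t)"
    unfolding gap_energy_def whole by (simp add: lessThan_atLeast0)
  also have "\<dots> \<le> (6 * real m * real n / s) ^ m * (1/\<rho>) ^ (n - 1 - 0) * width 0 (n - 1) 0 powr s"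
    using n s few by (intro energy_bound) auto
  also have "\<dots> \<le> (6 * real m * real n / s) ^ m * (1/\<rho>) ^ (n - 1 - 0) * 1"
    using initial_width_le[OF n x0] width_nonneg[of 0 "n - 1" 0] \<rho> n s
    by (intro mult_left_mono powr_le1) (auto simp: width_def)
  finally show "(\<Sum>t<T. \<Sum>p\<in>crossed_traj n P x0 t. gap (sorted_traj n P x0 t) p powr s)
      \<le> (6 * real m * real n / s) ^ m * (1/\<rho>) ^ (n - 1)" by simp
qed

theorem theorem1:
  shows "\<exists>C>0. \<forall>(n::nat) (\<rho>::real) (m::nat) (s::real).
     2 \<le> n \<longrightarrow> 0 < \<rho> \<longrightarrow> \<rho> \<le> 1/2 \<longrightarrow> 1 \<le> m \<longrightarrow> m \<le> n - 1 \<longrightarrow> 0 < s \<longrightarrow> s \<le> 1 \<longrightarrow>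
       max_energy n \<rho> m 1 \<le> ennreal (3 * exp 1 * real n * (1/\<rho>) ^ (n div 2)) \<and>
       max_energy n \<rho> m s \<le> ennreal ((C * real m * real n / s) ^ m * (1/\<rho>) ^ (n - 1))"
proof (intro exI[of _ 6] conjI allI impI)
  fix n m :: nat and \<rho> s :: real
  assume n: "2 \<le> n" and \<rho>: "0 < \<rho>" "\<rho> \<le> 1/2" and s: "0 < s" "s \<le> 1"
  show "max_energy n \<rho> m 1 \<le> ennreal (3 * exp 1 * real n * (1/\<rho>) ^ (n div 2))"
    unfolding max_energy_def
  proof (rule SUP_least, clarify)
    fix P and x0 :: "nat \<Rightarrow> real" assume "avg_system n \<rho> P" "\<forall>i<n. x0 i \<in> {0..1}"
    then show "energy n P x0 1 \<le> ennreal (3 * exp 1 * real n * (1/\<rho>) ^ (n div 2))"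
      using energy_one_le \<rho> n by blast
  qed
  \<comment> \<open>The witness 6 for the absolute constant is the one from
    \<open>energy_bound\<close>, with \<open>m\<close> in the role of both \<open>m\<close> and
    \<open>M\<close>.\<close>
  show "max_energy n \<rho> m s \<le> ennreal ((6 * real m * real n / s) ^ m * (1/\<rho>) ^ (n - 1))"
    unfolding max_energy_def
  proof (rule SUP_least, clarify)
    fix P and x0 :: "nat \<Rightarrow> real" assume "avg_system n \<rho> P" "\<forall>t. num_components n P t \<le> m" "\<forall>i<n. x0 i \<in> {0..1}"
    then show "energy n P x0 s \<le> ennreal ((6 * real m * real n / s) ^ m * (1/\<rho>) ^ (n - 1))"
      using energy_s_le \<rho> n s by blast
  qed
qed simp

end
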